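(* Let $d$ be a positive integer, and fix a $d$-bounded bipartite graph $H$ which contains $K_{d,s}$ as a subgraph with $s$ sufficiently large in terms of $d$. Then $r_{\mathrm{ind}}(H,r)=\tilde{\Theta}(r^d)$ as $r\to\infty$.
   Context: For a graph $H$ and positive integer $r$, the induced Ramsey number $r_{\mathrm{ind}}(H,r)$ is the minimum $N$ for which there is a graph $G$ on $N$ vertices such that in every $r$-edge-coloring of $G$ there is a monochromatic induced copy of $H$. A bipartite graph $H=(A\cup B,E)$ is $d$-bounded if there are between $1$ and $d$ vertices in $A$ adjacent to all vertices of $B$, and every other vertex of $A$ has degree at most $d$. $\tilde{\Theta}$ means up to factors polylogarithmic in $r$ (constants may depend on $H$). *)

theory Defs
  imports Complex_Main
begin

definition graph :: "'a set \<Rightarrow> 'a set set \<Rightarrow> bool" where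
  "graph V E \<longleftrightarrow> finite V \<and> E \<subseteq> {{u, v} | u v. u \<in> V \<and> v \<in> V \<and> u \<noteq> v}"

definition d_bounded :: "nat \<Rightarrow> 'a set \<Rightarrow> 'a set set \<Rightarrow> bool" where
  "d_bounded d V E \<longleftrightarrow> graph V E \<and>
     (\<exists>A B. A \<inter> B = {} \<and> A \<union> B = V \<and>
        (\<forall>e\<in>E. \<exists>a\<in>A. \<exists>b\<in>B. e = {a, b}) \<and>
        (let F = {a\<in>A. \<forall>b\<in>B. {a, b} \<in> E} in
          1 \<le> card F \<and> card F \<le> d \<and>
          (\<forall>a\<in>A - F. card {v\<in>V. {a, v} \<in> E} \<le> d)))"

definition contains_Kst :: "nat \<Rightarrow> nat \<Rightarrow> 'a set \<Rightarrow> 'a set set \<Rightarrow> bool" where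
  "contains_Kst d s V E \<longleftrightarrow> (\<exists>X Y. X \<subseteq> V \<and> Y \<subseteq> V \<and> X \<inter> Y = {} \<and>
      card X = d \<and> card Y = s \<and> (\<forall>x\<in>X. \<forall>y\<in>Y. {x, y} \<in> E))"

definition mono_induced_copy ::
  "'a set \<Rightarrow> 'a set set \<Rightarrow> 'b set \<Rightarrow> 'b set set \<Rightarrow> ('b set \<Rightarrow> nat) \<Rightarrow> bool" where
  "mono_induced_copy VH EH VG EG c \<longleftrightarrow>
     (\<exists>\<phi>. \<phi> ` VH \<subseteq> VG \<and> inj_on \<phi> VH \<and>
        (\<forall>u\<in>VH. \<forall>v\<in>VH. u \<noteq> v \<longrightarrow> ({u, v} \<in> EH \<longleftrightarrow> {\<phi> u, \<phi> v} \<in> EG)) \<and>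
        (\<exists>col. \<forall>e\<in>EH. c (\<phi> ` e) = col))"

definition ind_ramsey_graph ::
  "'a set \<Rightarrow> 'a set set \<Rightarrow> nat \<Rightarrow> 'b set \<Rightarrow> 'b set set \<Rightarrow> bool" where
  "ind_ramsey_graph VH EH r VG EG \<longleftrightarrow>
     (\<forall>c. (\<forall>e\<in>EG. c e < r) \<longrightarrow> mono_induced_copy VH EH VG EG c)"

definition r_ind :: "'a set \<Rightarrow> 'a set set \<Rightarrow> nat \<Rightarrow> nat" where
  "r_ind VH EH r = (LEAST N. \<exists>EG. graph {0..<N} EG \<and> ind_ramsey_graph VH EH r {0..<N} EG)"

definition Theta_tilde_pow :: "(nat \<Rightarrow> real) \<Rightarrow> nat \<Rightarrow> bool" where
  "Theta_tilde_pow f d \<longleftrightarrow>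
     (\<exists>c C a b. c > 0 \<and> C > 0 \<and> a \<ge> 0 \<and> b \<ge> 0 \<and>
        (\<forall>\<^sub>F r in sequentially.
           c * real r ^ d / (ln (real r)) powr a \<le> f r \<and>
           f r \<le> C * real r ^ d * (ln (real r)) powr b))"

end

theory Submission
  imports Defs "HOL-Algebra.Algebraic_Closure_Type" "HOL-Library.Z2" "HOL-Library.FuncSet"
begin

text \<open>
  Lower bound: with q = 2^k between r/2 and r, identify q^d vertices with the field of q^d elements
  and color the pair xy by the norm N(x + y), an element of the field of q elements. A monochromatic
  K_{d,s} gives s solutions x of a system N(x + a_j) = c with d distinct a_j. With x_i = x^(q^i) this
  reads (x_0 - a_{0j}) ... (x_{d-1} - a_{d-1,j}) = c. Such a system has no solution at infinity: if
  the coordinates in a nonempty set T are infinite, then for each of the d values of j some x_i with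
  i outside T equals a_{ij}, and by pigeonhole two values of j share the same i. Effectively, this
  rewrites monomials with large exponents into smaller ones, so that the functions on the solution
  set are spanned by a number of monomials that depends on d only.

  Upper bound: take a random-like bipartite graph on 2N vertices, dense but without K_{k,k} for
  k = O(log N). In the majority color, dependent random choice with d vertices f_1, ..., f_d yields
  their common neighborhood U, in which almost all d-tuples have polylogarithmically many common
  neighbors. The vertices of H adjacent to all of B are embedded among the f_i, the side B is mapped
  randomly into U, and since there is no K_{k,k} the required non-adjacencies are almost always
  available.
\<close>

section \<open>Systems of products of linear factors\<close>

text \<open>The sharp bound on the number of solutions is a matter of algebraic geometry. As
  \<open>s\<close> may be large in terms of \<open>d\<close>, any bound depending on
  \<open>d\<close> alone will do, and linear algebra gives one. Characteristic 2 serves twice: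
  powers of two provide a field order q with r/2 < q <= r for every r >= 2, and x + y = x - y turns
  the symmetric color N(x + y) into a product of differences. All pairs are colored, so one coloring
  defeats every host graph on at most q^d vertices. In the upper bound two relations are kept apart:
  edges must lie in one color class \<open>R'\<close>, non-edges must be absent from the whole host
  \<open>R\<close>. Vertices adjacent to all of B may have degree above d, so control of d-tuples
  cannot place them; being at most d in number, they fit among the chosen vertices. Each required
  non-adjacency divides the supply of candidates by 2k, so a supply of order (2k)^|V|,
  polylogarithmic in r, suffices. A majority color has density at least 1/(2r), and d vertices have
  about N/(2r)^d common neighbors on average, whence N is r^d up to logarithms.\<close>

lemma homogeneous_system_nontrivial:
  fixes g :: "'i \<Rightarrow> 's \<Rightarrow> 'k::field"
  assumes "finite K" "finite S" "card K < card S"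
  shows "\<exists>l. (\<exists>s\<in>S. l s \<noteq> 0) \<and> (\<forall>i\<in>K. (\<Sum>s\<in>S. l s * g i s) = 0)"
  using assms
proof (induction K arbitrary: S g rule: finite_induct)
  case empty
  then have "S \<noteq> {}" by auto
  then show ?case by (intro exI[of _ "\<lambda>_. 1"]) auto
next
  case (insert k K)
  show ?case
  proof (cases "\<forall>s\<in>S. g k s = 0")
    case True
    from insert.IH[of S g] insert.prems insert.hyps
    obtain l where "\<exists>s\<in>S. l s \<noteq> 0" "\<forall>i\<in>K. (\<Sum>s\<in>S. l s * g i s) = 0" by auto
    then show ?thesis using True by (intro exI[of _ l]) auto
  next
    case False
    then obtain s0 where s0: "s0 \<in> S" "g k s0 \<noteq> 0" by auto
    define S' where "S' = S - {s0}"
    define g' where "g' i s = g i s - g i s0 / g k s0 * g k s" for i s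
    have fin: "finite S'" and "card K < card S'"
      using insert.prems insert.hyps s0 by (auto simp: S'_def)
    from insert.IH[OF this, of g'] obtain l
      where l: "\<exists>s\<in>S'. l s \<noteq> 0" "\<forall>i\<in>K. (\<Sum>s\<in>S'. l s * g' i s) = 0" by auto
    define c where "c = - (\<Sum>s\<in>S'. l s * g k s) / g k s0"
    define l' where "l' s = (if s = s0 then c else l s)" for s
    have eq: "(\<Sum>s\<in>S. l' s * h s) = c * h s0 + (\<Sum>s\<in>S'. l s * h s)" for h :: "'s \<Rightarrow> 'k"
      using insert.prems s0 by (subst sum.remove[of _ s0]) (auto simp: l'_def S'_def intro!: sum.cong)
    have "(\<Sum>s\<in>S. l' s * g i s) = 0" if "i \<in> insert k K" for i
    proof (cases "i = k")
      case True
      then show ?thesis using s0 by (simp add: eq c_def)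
    next
      case False
      with that l have "0 = (\<Sum>s\<in>S'. l s * g' i s)" by auto
      also have "\<dots> = (\<Sum>s\<in>S'. l s * g i s) - g i s0 / g k s0 * (\<Sum>s\<in>S'. l s * g k s)"
        by (simp add: g'_def algebra_simps sum_subtractf sum_distrib_left)
      finally show ?thesis by (simp add: eq c_def)
    qed
    moreover have "\<exists>s\<in>S. l' s \<noteq> 0" using l(1) by (auto simp: l'_def S'_def)
    ultimately show ?thesis by blast
  qed
qed

text \<open>Functions are compared on \<open>S\<close> only, so this is the span of \<open>G\<close> restricted to \<open>S\<close>.\<close>
inductive_set comb :: "'s set \<Rightarrow> ('s \<Rightarrow> 'k::field) set \<Rightarrow> ('s \<Rightarrow> 'k) set" for S G where
  comb_zero: "(\<And>s. s \<in> S \<Longrightarrow> h s = 0) \<Longrightarrow> h \<in> comb S G"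
| comb_step: "g \<in> G \<Longrightarrow> f \<in> comb S G \<Longrightarrow> (\<And>s. s \<in> S \<Longrightarrow> h s = a * g s + f s) \<Longrightarrow> h \<in> comb S G"

lemma comb_cong:
  assumes "f \<in> comb S G" "\<And>s. s \<in> S \<Longrightarrow> h s = f s"
  shows "h \<in> comb S G"
  using assms
proof (induction rule: comb.induct)
  case (comb_zero f)
  then show ?case by (intro comb.comb_zero) auto
next
  case (comb_step g f h' a)
  then show ?case by (intro comb.comb_step[of g G f S h a]) auto
qed

lemma comb_base: "g \<in> G \<Longrightarrow> g \<in> comb S G"
  by (rule comb_step[of g G "\<lambda>_. 0" S g 1]) (auto intro: comb_zero)

lemma comb_plus:
  assumes "f \<in> comb S G" "g \<in> comb S G"
  shows "(\<lambda>s. f s + g s) \<in> comb S G"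
  using assms(1)
proof (induction rule: comb.induct)
  case (comb_zero f)
  then show ?case by (intro comb_cong[OF assms(2)]) auto
next
  case (comb_step g' f h a)
  show ?case
    by (rule comb.comb_step[OF comb_step(1,4), of _ a]) (simp add: comb_step(3) add.assoc)
qed

lemma comb_scale:
  assumes "f \<in> comb S G"
  shows "(\<lambda>s. c * f s) \<in> comb S G"
  using assms
proof (induction rule: comb.induct)
  case (comb_zero f)
  then show ?case by (intro comb.comb_zero) auto
next
  case (comb_step g' f h a)
  show ?case
    by (rule comb.comb_step[OF comb_step(1,4), of _ "c * a"]) (simp add: comb_step(3) algebra_simps)
qed

lemma comb_sum:
  assumes "\<And>i. i \<in> I \<Longrightarrow> f i \<in> comb S G"
  shows "(\<lambda>s. \<Sum>i\<in>I. f i s) \<in> comb S G"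
  using assms
proof (induction I rule: infinite_finite_induct)
  case (insert i I)
  have "(\<lambda>s. f i s + (\<Sum>i\<in>I. f i s)) \<in> comb S G"
    by (rule comb_plus) (use insert in auto)
  then show ?case using insert by simp
qed (auto intro: comb_zero)

lemma comb_trans:
  assumes "f \<in> comb S G" "\<And>g. g \<in> G \<Longrightarrow> g \<in> comb S G'"
  shows "f \<in> comb S G'"
  using assms(1)
proof (induction rule: comb.induct)
  case (comb_zero f)
  then show ?case by (rule comb.comb_zero)
next
  case (comb_step g' f h a)
  show ?case
    by (rule comb_cong[OF comb_plus[OF comb_scale[OF assms(2)[OF comb_step(1)], of a] comb_step(4)]])
       (simp add: comb_step(3))
qed

lemma comb_mult_base:
  assumes "f \<in> comb S G" "\<And>g. g \<in> G \<Longrightarrow> (\<lambda>s. u s * g s) \<in> comb S G'"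
  shows "(\<lambda>s. u s * f s) \<in> comb S G'"
  using assms(1)
proof (induction rule: comb.induct)
  case (comb_zero f)
  then show ?case by (intro comb.comb_zero) auto
next
  case (comb_step g' f h a)
  show ?case
    by (rule comb_cong[OF comb_plus[OF comb_scale[OF assms(2)[OF comb_step(1)], of a] comb_step(4)]])
       (simp add: comb_step(3) algebra_simps)
qed

lemma comb_mult:
  assumes "f1 \<in> comb S G1" "f2 \<in> comb S G2"
    and "\<And>g1 g2. g1 \<in> G1 \<Longrightarrow> g2 \<in> G2 \<Longrightarrow> (\<lambda>s. g1 s * g2 s) \<in> comb S G3"
  shows "(\<lambda>s. f1 s * f2 s) \<in> comb S G3"
proof (rule comb_mult_base[OF assms(2)])
  fix g assume g: "g \<in> G2"
  have "(\<lambda>s. g s * f1 s) \<in> comb S G3"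
    by (rule comb_mult_base[OF assms(1)]) (use assms(3)[OF _ g] in \<open>auto simp: mult.commute\<close>)
  then show "(\<lambda>s. f1 s * g s) \<in> comb S G3" by (simp add: mult.commute)
qed

text \<open>Spans are used only in this dual form: no dimension is bounded, but a functional
  \<open>l\<close> that vanishes on the generators is carried over to the whole span.\<close>

lemma comb_annihilated:
  assumes "f \<in> comb S G" "\<And>g. g \<in> G \<Longrightarrow> (\<Sum>s\<in>S. l s * g s) = 0"
  shows "(\<Sum>s\<in>S. l s * f s) = 0"
  using assms(1)
proof (induction rule: comb.induct)
  case (comb_step g f h a)
  have "(\<Sum>s\<in>S. l s * h s) = a * (\<Sum>s\<in>S. l s * g s) + (\<Sum>s\<in>S. l s * f s)"
    by (simp add: comb_step(3) algebra_simps sum.distrib sum_distrib_left)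
  then show ?case using comb_step assms(2) by simp
qed auto

section \<open>Monomials evaluated on the solution set\<close>

definition monom_fn :: "nat \<Rightarrow> (nat \<Rightarrow> 's \<Rightarrow> 'k::field) \<Rightarrow> (nat \<Rightarrow> nat) \<Rightarrow> 's \<Rightarrow> 'k" where
  "monom_fn d x e s = (\<Prod>i<d. x i s ^ e i)"

definition polys :: "'s set \<Rightarrow> nat \<Rightarrow> (nat \<Rightarrow> 's \<Rightarrow> 'k::field) \<Rightarrow> (nat \<Rightarrow> nat) set \<Rightarrow> ('s \<Rightarrow> 'k) set" where
  "polys S d x E = comb S (monom_fn d x ` E)"

lemma monom_fn_add: "monom_fn d x e s * monom_fn d x e' s = monom_fn d x (\<lambda>i. e i + e' i) s"
  by (simp add: monom_fn_def power_add prod.distrib)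

lemma monom_in_polys: "e \<in> E \<Longrightarrow> monom_fn d x e \<in> polys S d x E"
  by (auto simp: polys_def intro: comb_base)

lemma polys_mono: "f \<in> polys S d x E \<Longrightarrow> E \<subseteq> Y \<Longrightarrow> f \<in> polys S d x Y"
  unfolding polys_def by (erule comb_trans) (auto intro: comb_base)

lemma polys_mult:
  assumes "f1 \<in> polys S d x E1" "f2 \<in> polys S d x E2"
    and "\<And>e1 e2. e1 \<in> E1 \<Longrightarrow> e2 \<in> E2 \<Longrightarrow> (\<lambda>i. e1 i + e2 i) \<in> E3"
  shows "(\<lambda>s. f1 s * f2 s) \<in> polys S d x E3"
  unfolding polys_def
proof (rule comb_mult[OF assms(1,2)[unfolded polys_def]])
  fix g1 g2 assume "g1 \<in> monom_fn d x ` E1" "g2 \<in> monom_fn d x ` E2"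
  then obtain e1 e2 where "e1 \<in> E1" "e2 \<in> E2" "g1 = monom_fn d x e1" "g2 = monom_fn d x e2" by auto
  then show "(\<lambda>s. g1 s * g2 s) \<in> comb S (monom_fn d x ` E3)"
    using assms(3) by (auto simp: monom_fn_add intro!: comb_base)
qed

definition exps :: "nat set \<Rightarrow> nat \<Rightarrow> (nat \<Rightarrow> nat) set" where
  "exps I D = {e. \<forall>i. e i \<le> (if i \<in> I then D else 0)}"

lemma exps_add:
  assumes "e1 \<in> exps I1 D1" "e2 \<in> exps I2 D2" "I1 \<subseteq> I" "I2 \<subseteq> I" "D1 + D2 \<le> D"
  shows "(\<lambda>i. e1 i + e2 i) \<in> exps I D"
  unfolding exps_def
proof (intro CollectI allI)
  fix i
  have "e1 i \<le> (if i \<in> I1 then D1 else 0)" "e2 i \<le> (if i \<in> I2 then D2 else 0)"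
    using assms(1,2) by (auto simp: exps_def)
  then show "e1 i + e2 i \<le> (if i \<in> I then D else 0)"
    using assms(3-5) by (auto split: if_splits)
qed

text \<open>With disjoint supports the bounds combine by maximum instead of sum. This keeps the
  bound \<open>d\<close> fixed during the induction in
  \<open>partial_products_certificate\<close>.\<close>

lemma exps_add_disjoint:
  assumes "e1 \<in> exps I1 D1" "e2 \<in> exps I2 D2" "I1 \<subseteq> I" "I2 \<subseteq> I" "I1 \<inter> I2 = {}" "D1 \<le> D" "D2 \<le> D"
  shows "(\<lambda>i. e1 i + e2 i) \<in> exps I D"
  unfolding exps_def
proof (intro CollectI allI)
  fix i
  have "e1 i \<le> (if i \<in> I1 then D1 else 0)" "e2 i \<le> (if i \<in> I2 then D2 else 0)"
    using assms(1,2) by (auto simp: exps_def)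
  then show "e1 i + e2 i \<le> (if i \<in> I then D else 0)"
    using assms(3-7) by (cases "i \<in> I1"; cases "i \<in> I2") auto
qed

lemma monom_fn_0: "monom_fn d x (\<lambda>_. 0) = (\<lambda>s. 1)"
  by (auto simp: monom_fn_def)

lemma monom_fn_single: "i < d \<Longrightarrow> monom_fn d x (\<lambda>j. if j = i then n else 0) s = x i s ^ n"
proof -
  assume "i < d"
  have "(\<Prod>j<d. x j s ^ (if j = i then n else 0)) = (\<Prod>j<d. if j = i then x i s ^ n else 1)"
    by (rule prod.cong) auto
  then show ?thesis using \<open>i < d\<close> by (simp add: monom_fn_def)
qed

lemma polys_const: "(\<lambda>s. c) \<in> polys S d x (exps I D)"
proof -
  have "monom_fn d x (\<lambda>_. 0) \<in> polys S d x (exps I D)"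
    by (rule monom_in_polys) (auto simp: exps_def)
  from comb_scale[OF this[unfolded polys_def], of c] show ?thesis
    by (simp add: monom_fn_0 polys_def)
qed

lemma polys_linear:
  assumes "i < d" "i \<in> I" "D \<ge> 1"
  shows "(\<lambda>s. x i s - c) \<in> polys S d x (exps I D)"
proof -
  have "monom_fn d x (\<lambda>j. if j = i then 1 else 0) \<in> polys S d x (exps I D)"
    by (rule monom_in_polys) (use assms in \<open>auto simp: exps_def\<close>)
  then have "(\<lambda>s. x i s) \<in> polys S d x (exps I D)"
    unfolding polys_def by (rule comb_cong) (use assms in \<open>simp add: monom_fn_single\<close>)
  from comb_plus[OF this[unfolded polys_def] polys_const[unfolded polys_def], of "-c"]
  show ?thesis by (simp add: polys_def)
qed

lemma polys_prod_linear_same: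
  assumes "i < d" "finite J"
  shows "(\<lambda>s. \<Prod>j\<in>J. x i s - c j) \<in> polys S d x (exps {i} (card J))"
  using assms(2)
proof (induction J rule: finite_induct)
  case empty
  then show ?case using polys_const[of 1] by simp
next
  case (insert j J)
  have "(\<lambda>s. (x i s - c j) * (\<Prod>j\<in>J. x i s - c j)) \<in> polys S d x (exps {i} (card (insert j J)))"
    by (rule polys_mult[OF polys_linear[of i d "{i}" 1] insert.IH])
       (use insert assms in \<open>auto intro: exps_add\<close>)
  then show ?case using insert by simp
qed

lemma polys_prod_linear:
  assumes "finite I" "I \<subseteq> {..<d}"
  shows "(\<lambda>s. \<Prod>i\<in>I. x i s - c i) \<in> polys S d x (exps I 1)"
  using assms
proof (induction I rule: finite_induct)
  case empty
  then show ?case using polys_const[of 1] by simp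
next
  case (insert i I)
  have "(\<lambda>s. (x i s - c i) * (\<Prod>i\<in>I. x i s - c i)) \<in> polys S d x (exps (insert i I) 1)"
    by (rule polys_mult[OF polys_linear[of i d "{i}" 1] insert.IH])
       (use insert in \<open>auto intro!: exps_add_disjoint[of _ "{i}" 1 _ I 1]\<close>)
  then show ?case using insert by simp
qed

section \<open>No solutions at infinity, effectively\<close>

text \<open>Lagrange interpolation of the constant 1: two polynomials of degree below
  \<open>card J\<close> agree at the \<open>card J\<close> distinct nodes
  \<open>a j\<close>.\<close>

lemma lagrange_unity:
  fixes a :: "'j \<Rightarrow> 'k::field"
  assumes "finite J" "J \<noteq> {}" "inj_on a J"
  shows "(\<Sum>k\<in>J. (\<Prod>j\<in>J-{k}. z - a j) / (\<Prod>j\<in>J-{k}. a k - a j)) = 1"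
proof -
  define p where "p = (\<Sum>k\<in>J. smult (1 / (\<Prod>j\<in>J-{k}. a k - a j)) (\<Prod>j\<in>J-{k}. [:- a j, 1:]))"
  have pp: "poly p z = (\<Sum>k\<in>J. (\<Prod>j\<in>J-{k}. z - a j) / (\<Prod>j\<in>J-{k}. a k - a j))" for z
    by (simp add: p_def poly_sum poly_prod)
  have "p = 1"
  proof (rule poly_eqI_degree[of "a ` J"])
    fix z assume "z \<in> a ` J"
    then obtain i where i: "i \<in> J" "z = a i" by auto
    have "(\<Prod>j\<in>J-{k}. a i - a j) / (\<Prod>j\<in>J-{k}. a k - a j) = (if k = i then 1 else 0)" if "k \<in> J" for k
      using that i assms by (auto simp: inj_on_def intro: prod_zero)
    then have "poly p z = (\<Sum>k\<in>J. if k = i then 1 else 0)"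
      unfolding pp i(2) by (intro sum.cong) auto
    then show "poly p z = poly 1 z" using i assms by simp
  next
    have "degree (\<Prod>j\<in>J-{k}. [:- a j, 1:]) \<le> card J - 1" if "k \<in> J" for k
      using degree_prod_sum_le[of "J - {k}" "\<lambda>j. [:- a j, 1:]"] that assms by simp
    then have "degree p \<le> card J - 1"
      unfolding p_def by (intro degree_sum_le) (use assms in \<open>auto intro: order.trans[OF degree_smult_le]\<close>)
    moreover have "card J > 0" using assms by (simp add: card_gt_0_iff)
    ultimately show "degree p < card (a ` J)" using assms(3) by (simp add: card_image)
    show "degree (1 :: 'k poly) < card (a ` J)" using assms by (simp add: card_image card_gt_0_iff)
  qed
  then show ?thesis using pp[of z] by simp
qed


text \<open>An effective Nullstellensatz. At a common zero of the \<open>card I + 1\<close> products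
  every \<open>j\<close> would have some \<open>i\<close> with \<open>x i s = a i j\<close>, and two
  \<open>j\<close> would share an \<open>i\<close>, against injectivity. The induction on
  \<open>I\<close> turns this pigeonhole argument into explicit coefficients of bounded
  degree.\<close>

lemma partial_products_certificate:
  fixes x :: "nat \<Rightarrow> 's \<Rightarrow> 'k::field" and a :: "nat \<Rightarrow> 'j \<Rightarrow> 'k"
  assumes "finite I" "I \<subseteq> {..<d}" "finite J" "card J = Suc (card I)"
    and "\<And>i. i \<in> I \<Longrightarrow> inj_on (a i) J"
  shows "\<exists>h. (\<forall>j\<in>J. h j \<in> polys S d x (exps I d)) \<and>
             (\<forall>s\<in>S. (\<Sum>j\<in>J. h j s * (\<Prod>i\<in>I. x i s - a i j)) = 1)"
  using assms
proof (induction I arbitrary: J rule: finite_induct)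
  case empty
  then obtain j where "J = {j}" by (auto simp: card_Suc_eq)
  then show ?case by (intro exI[of _ "\<lambda>_ _. 1"]) (auto intro: polys_const)
next
  case (insert i0 I)
  have i0: "i0 < d" and I: "I \<subseteq> {..<d}" using insert.prems by auto
  have cI: "card I \<le> d" using card_mono[OF _ I] by simp
  have "\<forall>k\<in>J. \<exists>h. (\<forall>j\<in>J - {k}. h j \<in> polys S d x (exps I d)) \<and>
             (\<forall>s\<in>S. (\<Sum>j\<in>J - {k}. h j s * (\<Prod>i\<in>I. x i s - a i j)) = 1)"
  proof
    fix k assume k: "k \<in> J"
    show "\<exists>h. (\<forall>j\<in>J - {k}. h j \<in> polys S d x (exps I d)) \<and>
             (\<forall>s\<in>S. (\<Sum>j\<in>J - {k}. h j s * (\<Prod>i\<in>I. x i s - a i j)) = 1)"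
    proof (rule insert.IH)
      fix i assume "i \<in> I"
      then show "inj_on (a i) (J - {k})"
        using insert.prems(4)[of i] by (auto intro: inj_on_subset)
    qed (use insert k in auto)
  qed
  from bchoice[OF this] obtain H where
    "\<forall>k\<in>J. (\<forall>j\<in>J - {k}. H k j \<in> polys S d x (exps I d)) \<and>
        (\<forall>s\<in>S. (\<Sum>j\<in>J - {k}. H k j s * (\<Prod>i\<in>I. x i s - a i j)) = 1)" ..
  then have H: "\<And>k j. k \<in> J \<Longrightarrow> j \<in> J - {k} \<Longrightarrow> H k j \<in> polys S d x (exps I d)"
    and H1: "\<And>k s. k \<in> J \<Longrightarrow> s \<in> S \<Longrightarrow> (\<Sum>j\<in>J - {k}. H k j s * (\<Prod>i\<in>I. x i s - a i j)) = 1"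
    by blast+
  define c where "c k = 1 / (\<Prod>j\<in>J-{k}. a i0 k - a i0 j)" for k
  \<comment> \<open>The factor with index \<open>j\<close> is left out here because it completes the
    product over \<open>I\<close> to the product over \<open>insert i0 I\<close>.\<close>
  define h where "h j s = (\<Sum>k\<in>J-{j}. c k * (H k j s * (\<Prod>j'\<in>J-{k}-{j}. x i0 s - a i0 j')))" for j s
  \<comment> \<open>Omitting the index \<open>k\<close> exhibits \<open>\<Prod>j\<in>J-{k}. x i0 s - a i0 j\<close> as a combination; these products,
    for varying \<open>k\<close>, sum to \<open>1\<close> with the Lagrange coefficients \<open>c k\<close>.\<close>
  have "h j \<in> polys S d x (exps (insert i0 I) d)" if j: "j \<in> J" for j
    unfolding h_def polys_def
  proof (intro comb_sum comb_scale, fold polys_def)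
    fix k assume k: "k \<in> J - {j}"
    have "card (J - {k}) = Suc (card I)" using k insert.prems insert.hyps by simp
    moreover have "card (J - {k} - {j}) = card (J - {k}) - 1"
      by (rule card_Diff_singleton) (use k j in auto)
    ultimately have "card (J - {k} - {j}) = card I" by (simp only: diff_Suc_1)
    moreover have "(\<lambda>s. \<Prod>j'\<in>J-{k}-{j}. x i0 s - a i0 j') \<in> polys S d x (exps {i0} (card (J-{k}-{j})))"
      by (rule polys_prod_linear_same) (use i0 insert.prems in auto)
    ultimately have *: "(\<lambda>s. \<Prod>j'\<in>J-{k}-{j}. x i0 s - a i0 j') \<in> polys S d x (exps {i0} (card I))" by simp
    show "(\<lambda>s. H k j s * (\<Prod>j'\<in>J-{k}-{j}. x i0 s - a i0 j')) \<in> polys S d x (exps (insert i0 I) d)"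
      by (rule polys_mult[OF H *]) (use k j insert.hyps cI in \<open>auto intro!: exps_add_disjoint[of _ I d _ "{i0}" "card I"]\<close>)
  qed
  moreover have "(\<Sum>j\<in>J. h j s * (\<Prod>i\<in>insert i0 I. x i s - a i j)) = 1" if s: "s \<in> S" for s
  proof -
    define g where "g j = (\<Prod>i\<in>I. x i s - a i j)" for j
    define y where "y j = x i0 s - a i0 j" for j
    have "(\<Sum>j\<in>J. h j s * (\<Prod>i\<in>insert i0 I. x i s - a i j)) =
          (\<Sum>j\<in>J. \<Sum>k | k \<in> J \<and> j \<noteq> k. c k * (H k j s * (\<Prod>j'\<in>J-{k}. y j')) * g j)"
    proof (rule sum.cong)
      fix j assume j: "j \<in> J"
      have "h j s * (\<Prod>i\<in>insert i0 I. x i s - a i j) =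
            (\<Sum>k\<in>J-{j}. c k * (H k j s * (\<Prod>j'\<in>J-{k}-{j}. y j')) * (y j * g j))"
        using insert.hyps by (simp add: h_def sum_distrib_right g_def y_def)
      also have "\<dots> = (\<Sum>k\<in>J-{j}. c k * (H k j s * (\<Prod>j'\<in>J-{k}. y j')) * g j)"
      proof (rule sum.cong)
        fix k assume "k \<in> J - {j}"
        then have "(\<Prod>j'\<in>J-{k}. y j') = y j * (\<Prod>j'\<in>J-{k}-{j}. y j')"
          using j insert.prems by (intro prod.remove) auto
        then show "c k * (H k j s * (\<Prod>j'\<in>J-{k}-{j}. y j')) * (y j * g j) =
          c k * (H k j s * (\<Prod>j'\<in>J-{k}. y j')) * g j" by (simp add: mult_ac)
      qed simp
      also have "J - {j} = {k. k \<in> J \<and> j \<noteq> k}" by auto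
      finally show "h j s * (\<Prod>i\<in>insert i0 I. x i s - a i j) =
         (\<Sum>k | k \<in> J \<and> j \<noteq> k. c k * (H k j s * (\<Prod>j'\<in>J-{k}. y j')) * g j)" .
    qed simp
    also have "\<dots> = (\<Sum>k\<in>J. \<Sum>j | j \<in> J \<and> j \<noteq> k. c k * (H k j s * (\<Prod>j'\<in>J-{k}. y j')) * g j)"
      using insert.prems by (intro sum.swap_restrict) auto
    also have "\<dots> = (\<Sum>k\<in>J. c k * (\<Prod>j'\<in>J-{k}. y j'))"
    proof (rule sum.cong)
      fix k assume k: "k \<in> J"
      have "{j. j \<in> J \<and> j \<noteq> k} = J - {k}" by auto
      then have "(\<Sum>j | j \<in> J \<and> j \<noteq> k. c k * (H k j s * (\<Prod>j'\<in>J-{k}. y j')) * g j)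
         = c k * (\<Prod>j'\<in>J-{k}. y j') * (\<Sum>j\<in>J-{k}. H k j s * g j)"
        by (simp add: sum_distrib_left mult_ac)
      then show "(\<Sum>j | j \<in> J \<and> j \<noteq> k. c k * (H k j s * (\<Prod>j'\<in>J-{k}. y j')) * g j) =
         c k * (\<Prod>j'\<in>J-{k}. y j')"
        using H1[OF k s] by (simp add: g_def)
    qed simp
    also have "\<dots> = (\<Sum>k\<in>J. (\<Prod>j\<in>J-{k}. x i0 s - a i0 j) / (\<Prod>j\<in>J-{k}. a i0 k - a i0 j))"
      by (simp add: c_def y_def)
    also have "\<dots> = 1"
      by (rule lagrange_unity) (use insert.prems in auto)
    finally show ?thesis .
  qed
  ultimately show ?case by blast
qed

text \<open>The exponents that may occur when the factors \<open>x i\<close> with \<open>i \<in> T\<close> are rewritten; if those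
  exponents exceed all others by a gap of more than \<open>d + 2\<close>, the weight in \<open>weight_decrease\<close> below drops.\<close>
definition lower_exps :: "nat \<Rightarrow> nat set \<Rightarrow> (nat \<Rightarrow> nat) \<Rightarrow> (nat \<Rightarrow> nat) set" where
  "lower_exps d T e = {e'. (\<forall>i\<in>T. e' i \<le> e i) \<and> (\<exists>i\<in>T. e' i < e i) \<and>
     (\<forall>i\<in>{..<d} - T. e' i \<le> e i + Suc d)}"

text \<open>The coordinates in \<open>T\<close> act as the infinite ones. Write 1 as the sum of
  \<open>h j * g j\<close>, where \<open>g j\<close> is the product over the complement of
  \<open>T\<close>. Then \<open>g j\<close> times the product over \<open>T\<close> is the constant
  \<open>b j\<close>, and expanding the latter product trades the monomial over \<open>T\<close> for
  terms that each lack a factor. Multiplying by \<open>h j\<close> and \<open>g j\<close> raises the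
  other exponents by at most \<open>d + 1\<close>.\<close>

lemma monom_reduction:
  fixes x :: "nat \<Rightarrow> 's \<Rightarrow> 'k::field"
  assumes sys: "\<And>s j. s \<in> S \<Longrightarrow> j < d \<Longrightarrow> (\<Prod>i<d. x i s - a i j) = b j"
    and inj: "\<And>i. i < d \<Longrightarrow> inj_on (a i) {..<d}"
    and T: "T \<subseteq> {..<d}" "T \<noteq> {}" and e: "\<And>i. i \<in> T \<Longrightarrow> e i \<ge> 1"
  shows "monom_fn d x e \<in> polys S d x (lower_exps d T e)"
proof -
  define I where "I = {..<d} - T"
  define J where "J = {..card I}"
  have finT: "finite T" using T finite_subset by blast
  \<comment> \<open>As \<open>T\<close> is nonempty, the \<open>card I + 1\<close> indices in
    \<open>J\<close> all lie below \<open>d\<close>, so the system has an equation for each.\<close>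
  have cI: "card I < d"
    using T psubset_card_mono[of "{..<d}" I] by (auto simp: I_def)
  obtain h where h: "\<And>j. j \<in> J \<Longrightarrow> h j \<in> polys S d x (exps I d)"
    and h1: "\<And>s. s \<in> S \<Longrightarrow> (\<Sum>j\<in>J. h j s * (\<Prod>i\<in>I. x i s - a i j)) = 1"
  proof -
    have "inj_on (a i) J" if "i \<in> I" for i
      by (rule inj_on_subset[OF inj]) (use that cI in \<open>auto simp: I_def J_def\<close>)
    from partial_products_certificate[where I = I and d = d and S = S and x = x, OF _ _ _ _ this]
    have "\<exists>h. (\<forall>j\<in>J. h j \<in> polys S d x (exps I d)) \<and>
      (\<forall>s\<in>S. (\<Sum>j\<in>J. h j s * (\<Prod>i\<in>I. x i s - a i j)) = 1)"
      by (simp add: I_def J_def)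
    then show ?thesis using that by blast
  qed
  define g where "g j s = (\<Prod>i\<in>I. x i s - a i j)" for j s
  define m where "m Y s = (\<Prod>i\<in>Y. x i s)" for Y s
  define e' where "e' i = e i - (if i \<in> T then 1 else 0)" for i
  define c where "c j Y = (\<Prod>i\<in>T-Y. - a i j)" for j Y
  have me': "m Y s * monom_fn d x e' s = monom_fn d x (\<lambda>i. e' i + (if i \<in> Y then 1 else 0)) s"
    if "Y \<subseteq> T" for Y s
  proof -
    have "m Y s = (\<Prod>i<d. if i \<in> Y then x i s else 1)"
      using that T by (subst prod.inter_restrict[symmetric]) (auto simp: m_def intro!: prod.cong)
    also have "\<dots> = monom_fn d x (\<lambda>i. if i \<in> Y then 1 else 0) s"
      by (auto simp: monom_fn_def intro!: prod.cong)
    finally show ?thesis by (simp add: monom_fn_add add.commute)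
  qed
  have main: "(\<lambda>s. f s * (m Y s * monom_fn d x e' s)) \<in> polys S d x (lower_exps d T e)"
    if f: "f \<in> polys S d x (exps I (Suc d))" and Y: "Y \<subset> T" for f Y
  proof -
    have "(\<lambda>s. m Y s * monom_fn d x e' s) \<in> polys S d x {\<lambda>i. e' i + (if i \<in> Y then 1 else 0)}"
      using me'[of Y] Y by (auto intro: monom_in_polys)
    from f this show ?thesis
    proof (rule polys_mult)
      fix e1 e2 assume e1: "e1 \<in> exps I (Suc d)" and "e2 \<in> {\<lambda>i. e' i + (if i \<in> Y then 1 else 0)}"
      then have e2: "e2 i = e' i + (if i \<in> Y then 1 else 0)" for i by auto
      obtain i0 where i0: "i0 \<in> T" "i0 \<notin> Y" using Y by auto
      have e1T: "e1 i = 0" if "i \<in> T" for i using e1 that by (auto simp: exps_def I_def dest!: spec[of _ i])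
      have e1I: "e1 i \<le> Suc d" for i using e1 by (auto simp: exps_def split: if_splits dest!: spec[of _ i])
      have "e1 i0 + e2 i0 < e i0" using i0 e[of i0] e1T by (simp add: e2 e'_def)
      moreover have "e1 i + e2 i \<le> e i" if "i \<in> T" for i
        using that e[of i] e1T by (simp add: e2 e'_def)
      moreover have "e1 i + e2 i \<le> e i + Suc d" if "i \<in> {..<d} - T" for i
        using that Y e1I[of i] by (auto simp add: e2 e'_def)
      ultimately show "(\<lambda>i. e1 i + e2 i) \<in> lower_exps d T e"
        using i0 unfolding lower_exps_def by blast
    qed
  qed
  have hg: "(\<lambda>s. h j s * g j s) \<in> polys S d x (exps I (Suc d))" if "j \<in> J" for j
    unfolding g_def
    by (rule polys_mult[OF h[OF that] polys_prod_linear]) (auto simp: I_def intro: exps_add)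
  have h': "h j \<in> polys S d x (exps I (Suc d))" if "j \<in> J" for j
    by (rule polys_mono[OF h[OF that]]) (auto simp: exps_def intro: le_SucI split: if_splits)
  \<comment> \<open>The term with \<open>b j\<close> stems from the full product over
    \<open>T\<close>, the terms with \<open>Y\<close> from its expansion. \<open>m {}\<close> is 1
    and only puts the first term into the form required by \<open>main\<close>.\<close>
  have "(\<lambda>s. \<Sum>j\<in>J. b j * (h j s * (m {} s * monom_fn d x e' s)) +
          (\<Sum>Y\<in>Pow T - {T}. - c j Y * (h j s * g j s * (m Y s * monom_fn d x e' s))))
        \<in> polys S d x (lower_exps d T e)"
    unfolding polys_def
  proof (intro comb_sum comb_plus comb_scale, fold polys_def)
    fix j assume j: "j \<in> J"
    show "(\<lambda>s. h j s * (m {} s * monom_fn d x e' s)) \<in> polys S d x (lower_exps d T e)"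
      by (rule main) (use h'[OF j] T in auto)
    fix Y assume "Y \<in> Pow T - {T}"
    then show "(\<lambda>s. h j s * g j s * (m Y s * monom_fn d x e' s)) \<in> polys S d x (lower_exps d T e)"
      by (intro main hg j) auto
  qed
  then show ?thesis unfolding polys_def
  proof (rule comb_cong)
    fix s assume s: "s \<in> S"
    have split: "m T s = (\<Prod>i\<in>T. x i s - a i j) - (\<Sum>Y\<in>Pow T - {T}. m Y s * c j Y)" for j
    proof -
      have "(\<Prod>i\<in>T. x i s + - a i j) = (\<Sum>Y\<in>Pow T. m Y s * c j Y)"
        unfolding m_def c_def by (rule prod_add[OF finT])
      also have "\<dots> = m T s * c j T + (\<Sum>Y\<in>Pow T - {T}. m Y s * c j Y)"
        by (rule sum.remove) (use finT in auto)
      finally show ?thesis by (simp add: c_def)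
    qed
    have gT: "g j s * (\<Prod>i\<in>T. x i s - a i j) = b j" if "j \<in> J" for j
    proof -
      have "(\<Prod>i<d. x i s - a i j) = g j s * (\<Prod>i\<in>T. x i s - a i j)"
        unfolding g_def I_def by (rule prod.subset_diff) (use T in auto)
      moreover have "j < d" using that cI by (auto simp: J_def)
      ultimately show ?thesis using sys[OF s] by simp
    qed
    have "monom_fn d x e s = m T s * monom_fn d x e' s"
    proof -
      have "(\<lambda>i. e' i + (if i \<in> T then 1 else 0)) = e"
      proof
        fix i show "e' i + (if i \<in> T then 1 else 0) = e i"
          using e[of i] by (auto simp: e'_def)
      qed
      then show ?thesis using me'[of T s] by simp
    qed
    also have "m T s = (\<Sum>j\<in>J. h j s * g j s * m T s)"
      using h1[OF s] by (simp add: g_def sum_distrib_right[symmetric])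
    also have "\<dots> = (\<Sum>j\<in>J. b j * h j s + (\<Sum>Y\<in>Pow T - {T}. - c j Y * (h j s * g j s * m Y s)))"
    proof (rule sum.cong)
      fix j assume j: "j \<in> J"
      have "h j s * g j s * m T s = h j s * (g j s * (\<Prod>i\<in>T. x i s - a i j))
          - h j s * g j s * (\<Sum>Y\<in>Pow T - {T}. m Y s * c j Y)"
        unfolding split[of j] by (simp add: algebra_simps)
      also have "\<dots> = b j * h j s + (\<Sum>Y\<in>Pow T - {T}. - c j Y * (h j s * g j s * m Y s))"
        unfolding gT[OF j] by (simp add: sum_distrib_left sum_negf mult_ac)
      finally show "h j s * g j s * m T s =
        b j * h j s + (\<Sum>Y\<in>Pow T - {T}. - c j Y * (h j s * g j s * m Y s))" .
    qed simp
    finally show "monom_fn d x e s = (\<Sum>j\<in>J. b j * (h j s * (m {} s * monom_fn d x e' s)) +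
          (\<Sum>Y\<in>Pow T - {T}. - c j Y * (h j s * g j s * (m Y s * monom_fn d x e' s))))"
      by (simp add: m_def sum_distrib_right distrib_right mult.assoc)
  qed
qed

section \<open>Termination of the rewriting and the solution count\<close>

text \<open>The coordinates other than \<open>i0\<close> are fewer than \<open>d\<close>, so some
  level \<open>l\<close> among 0, ..., d - 1 is not a value of \<open>e i div w\<close> for any of
  them, while \<open>i0\<close> lies at level \<open>d\<close> or higher. \<open>T\<close> collects
  the coordinates above the empty level, which forms the gap.\<close>

lemma exponent_gap:
  fixes e :: "nat \<Rightarrow> nat"
  assumes "i0 < d" "d * w \<le> e i0" "w \<ge> 1"
  shows "\<exists>T\<subseteq>{..<d}. i0 \<in> T \<and> (\<forall>i\<in>T. w \<le> e i \<and> (\<forall>i'\<in>{..<d} - T. e i' + w < e i))"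
proof -
  let ?f = "\<lambda>i. e i div w"
  have "card (?f ` ({..<d} - {i0})) \<le> card ({..<d} - {i0})" by (rule card_image_le) simp
  also have "\<dots> < card {..<d}" using assms by simp
  finally have "\<not> {..<d} \<subseteq> ?f ` ({..<d} - {i0})"
    using card_mono[of "?f ` ({..<d} - {i0})" "{..<d}"] by auto
  then obtain l where l: "l < d" "\<And>i. i < d \<Longrightarrow> i \<noteq> i0 \<Longrightarrow> ?f i \<noteq> l" by blast
  have f0: "?f i0 \<ge> d" using assms(2,3) by (simp add: less_eq_div_iff_mult_less_eq)
  define T where "T = {i. i < d \<and> ?f i > l}"
  have "w \<le> e i \<and> (\<forall>i'\<in>{..<d} - T. e i' + w < e i)" if i: "i \<in> T" for i
  proof
    have "Suc l \<le> ?f i" using i by (auto simp: T_def)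
    then have ge: "Suc l * w \<le> e i" using assms(3) by (simp add: less_eq_div_iff_mult_less_eq)
    then show "w \<le> e i" by simp
    show "\<forall>i'\<in>{..<d} - T. e i' + w < e i"
    proof
      fix i' assume i': "i' \<in> {..<d} - T"
      then have "?f i' < l" using l(2)[of i'] l(1) f0 by (cases "i' = i0") (auto simp: T_def)
      then have "e i' < l * w" using assms(3) by (simp add: div_less_iff_less_mult)
      then show "e i' + w < e i" using ge by simp
    qed
  qed
  moreover have "i0 \<in> T" "T \<subseteq> {..<d}" using f0 l assms by (auto simp: T_def)
  ultimately show ?thesis by blast
qed

text \<open>In base \<open>Suc d\<close>, lowering the exponent at \<open>i0\<close> pays for
  \<open>d\<close> coordinates outside \<open>T\<close>, which by the gap stay at exponent
  \<open>e i0 - 1\<close> or less, and for the new term at \<open>i0\<close> itself.\<close>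

lemma weight_decrease:
  assumes "e' \<in> lower_exps d T e" "T \<subseteq> {..<d}" "T \<noteq> {}"
    and gap: "\<And>i i'. i \<in> T \<Longrightarrow> i' \<in> {..<d} - T \<Longrightarrow> e i' + (d + 2) < e i"
  shows "(\<Sum>i<d. Suc d ^ e' i) < (\<Sum>i<d. Suc d ^ e i)"
proof -
  obtain i0 where i0: "i0 \<in> T" "e' i0 < e i0" using assms(1) by (auto simp: lower_exps_def)
  then have "i0 < d" using assms by auto
  have fT: "finite T" using assms(2) finite_subset by blast
  define A where "A = {..<d} - T"
  have cA: "card A \<le> d" using card_mono[of "{..<d}" A] by (simp add: A_def)
  have split: "(\<Sum>i<d. f i) = (\<Sum>i\<in>A. f i) + (f i0 + (\<Sum>i\<in>T-{i0}. f i))" for f :: "nat \<Rightarrow> nat"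
    using sum.subset_diff[OF assms(2), of f] sum.remove[OF fT i0(1), of f] by (simp add: A_def)
  have "(\<Sum>i\<in>A. Suc d ^ e' i) \<le> (\<Sum>i\<in>A. Suc d ^ (e i0 - 1))"
  proof (rule sum_mono)
    fix i assume i: "i \<in> A"
    have "e' i \<le> e i + Suc d" using assms(1) i by (auto simp: lower_exps_def A_def)
    also have "\<dots> \<le> e i0 - 1" using gap[OF i0(1), of i] i by (simp add: A_def)
    finally show "Suc d ^ e' i \<le> Suc d ^ (e i0 - 1)" by (rule power_increasing) simp
  qed
  also have "\<dots> \<le> d * Suc d ^ (e i0 - 1)" using cA by simp
  finally have 1: "(\<Sum>i\<in>A. Suc d ^ e' i) \<le> d * Suc d ^ (e i0 - 1)" .
  have 2: "Suc d ^ e' i0 \<le> Suc d ^ (e i0 - 1)" using i0 by (intro power_increasing) auto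
  have 3: "(\<Sum>i\<in>T-{i0}. Suc d ^ e' i) \<le> (\<Sum>i\<in>T-{i0}. Suc d ^ e i)"
    using assms(1) by (intro sum_mono power_increasing) (auto simp: lower_exps_def)
  have 4: "Suc d ^ e i0 = d * Suc d ^ (e i0 - 1) + Suc d ^ (e i0 - 1)"
    using i0 by (cases "e i0") auto
  show ?thesis
  proof (cases "A = {}")
    case True
    have "Suc d ^ e' i0 < Suc d ^ e i0"
      using i0 \<open>i0 < d\<close> by (intro power_strict_increasing) auto
    then show ?thesis using 3 True unfolding split[of "\<lambda>i. Suc d ^ e' i"] split[of "\<lambda>i. Suc d ^ e i"] by simp
  next
    case False
    \<comment> \<open>The other estimates are weak; strictness comes from the old terms outside
      \<open>T\<close>, which are positive.\<close>
    have pos: "0 < (\<Sum>i\<in>A. Suc d ^ e i)"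
      using False by (intro sum_pos) (auto simp: A_def)
    show ?thesis unfolding split[of "\<lambda>i. Suc d ^ e' i"] split[of "\<lambda>i. Suc d ^ e i"]
      using 1 2 3 4 pos by linarith
  qed
qed

lemma polys_annihilated:
  assumes "f \<in> polys S d x E" "\<And>e. e \<in> E \<Longrightarrow> (\<Sum>s\<in>S. l s * monom_fn d x e s) = 0"
  shows "(\<Sum>s\<in>S. l s * f s) = 0"
  using assms(1) unfolding polys_def by (rule comb_annihilated) (use assms(2) in auto)

text \<open>If \<open>S\<close> had more points than there are monomials with all exponents below
  \<open>B\<close>, some nonzero functional \<open>l\<close> would vanish on these monomials.
  Rewriting with decreasing weight extends this to all monomials, yet the powers of the injective
  coordinate \<open>x 0\<close> separate the points of \<open>S\<close>.\<close>

lemma card_solutions_le: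
  fixes x :: "nat \<Rightarrow> 's \<Rightarrow> 'k::field"
  assumes sys: "\<And>s j. s \<in> S \<Longrightarrow> j < d \<Longrightarrow> (\<Prod>i<d. x i s - a i j) = b j"
    and inj: "\<And>i. i < d \<Longrightarrow> inj_on (a i) {..<d}"
    and x0: "inj_on (x 0) S" and fin: "finite S" and d: "d > 0"
  shows "card S \<le> (d * (d + 3)) ^ d"
proof (rule ccontr)
  \<comment> \<open>\<open>exponent_gap\<close> asks for an exponent of at least
    \<open>d * w\<close>; the choice \<open>w = d + 3\<close> gives the gap needed in
    \<open>weight_decrease\<close>.\<close>
  define B where "B = d * (d + 3)"
  define P where "P = ({..<d} \<rightarrow>\<^sub>E {..<B})"
  assume "\<not> card S \<le> (d * (d + 3)) ^ d"
  moreover have "card P = B ^ d" by (simp add: P_def card_PiE)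
  ultimately have "card P < card S" by (simp add: B_def)
  moreover have "finite P" unfolding P_def by (intro finite_PiE) auto
  ultimately obtain l where l: "\<exists>s\<in>S. l s \<noteq> 0"
    and lP: "\<And>e. e \<in> P \<Longrightarrow> (\<Sum>s\<in>S. l s * monom_fn d x e s) = 0"
    using homogeneous_system_nontrivial[of P S "monom_fn d x"] fin by metis
  have all: "(\<Sum>s\<in>S. l s * monom_fn d x e s) = 0" for e
  proof (induction e rule: measure_induct_rule[of "\<lambda>e. \<Sum>i<d. Suc d ^ e i"])
    case (less e)
    show ?case
    proof (cases "\<forall>i<d. e i < B")
      case True
      then have "restrict e {..<d} \<in> P" by (auto simp: P_def)
      from lP[OF this] show ?thesis by (simp add: monom_fn_def)
    next
      case False
      then obtain i0 where i0: "i0 < d" "d * (d + 3) \<le> e i0" by (auto simp: B_def)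
      have "1 \<le> d + 3" by simp
      from exponent_gap[of i0 d "d + 3" e, OF i0 this] obtain T where T: "T \<subseteq> {..<d}" "i0 \<in> T"
        and gap': "\<forall>i\<in>T. d + 3 \<le> e i \<and> (\<forall>i'\<in>{..<d} - T. e i' + (d + 3) < e i)" by blast
      have gap: "d + 3 \<le> e i" if "i \<in> T" for i using gap' that by blast
      have gap2: "e i' + (d + 3) < e i" if "i \<in> T" "i' \<in> {..<d} - T" for i i'
        using gap' that by blast
      have "monom_fn d x e \<in> polys S d x (lower_exps d T e)"
        proof (rule monom_reduction[OF sys inj])
        show "1 \<le> e i" if "i \<in> T" for i using gap[OF that] by simp
      qed (use T in auto)
      then show ?thesis
      proof (rule polys_annihilated)
        fix e' assume e': "e' \<in> lower_exps d T e"
        show "(\<Sum>s\<in>S. l s * monom_fn d x e' s) = 0"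
        proof (rule less, rule weight_decrease[OF e' T(1)])
          show "T \<noteq> {}" using T by auto
          show "e i' + (d + 2) < e i" if "i \<in> T" "i' \<in> {..<d} - T" for i i'
            using gap2[OF that] by simp
        qed
      qed
    qed
  qed
  obtain s1 where s1: "s1 \<in> S" "l s1 \<noteq> 0" using l by auto
  \<comment> \<open>As a polynomial in \<open>x 0\<close>, \<open>p\<close> vanishes on all of
    \<open>S\<close> except at \<open>s1\<close>, so \<open>l\<close> applied to it isolates
    \<open>l s1\<close>.\<close>
  define p where "p = (\<Prod>s\<in>S-{s1}. [:- x 0 s, 1:])"
  have pz: "poly p (x 0 s) = 0 \<longleftrightarrow> s \<noteq> s1" if "s \<in> S" for s
    using that s1 fin x0 by (auto simp: p_def poly_prod inj_on_def)
  have "(\<Sum>s\<in>S. l s * x 0 s ^ n) = 0" for n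
    using all[of "\<lambda>j. if j = 0 then n else 0"] d by (simp add: monom_fn_single)
  then have "0 = (\<Sum>n\<le>degree p. coeff p n * (\<Sum>s\<in>S. l s * x 0 s ^ n))" by simp
  also have "\<dots> = (\<Sum>s\<in>S. l s * poly p (x 0 s))"
    unfolding poly_altdef sum_distrib_left by (subst sum.swap) (simp add: mult_ac)
  also have "\<dots> = (\<Sum>s\<in>S. if s = s1 then l s1 * poly p (x 0 s1) else 0)"
    by (rule sum.cong) (use pz in auto)
  also have "\<dots> = l s1 * poly p (x 0 s1)" using fin s1 by simp
  finally show False using s1 pz[of s1] by simp
qed

section \<open>The norm coloring\<close>

lemma CHAR_bit: "CHAR(bit) = 2"
proof (rule CHAR_eqI)
  show "of_nat 2 = (0 :: bit)" by simp
  show "2 dvd n" if "of_nat n = (0 :: bit)" for n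
    using that by (metis even_of_nat even_zero)
qed

lemma frobenius_add:
  fixes x y :: "bit alg_closure"
  shows "(x + y) ^ (2 ^ n) = x ^ (2 ^ n) + y ^ (2 ^ n)"
  by (rule freshmans_dream'[of _ n]) (simp_all add: CHAR_bit)

lemma two_ac: "2 = (0 :: bit alg_closure)"
  using of_nat_CHAR[where 'a = "bit alg_closure"] by (simp add: CHAR_bit)

lemma minus_ac: "- x = (x :: bit alg_closure)"
proof -
  have "x + x = 2 * x" by simp
  then have "x + x = 0" by (simp add: two_ac)
  then show ?thesis by (simp add: eq_neg_iff_add_eq_0 minus_equation_iff)
qed

lemma frobenius_inj:
  fixes x y :: "bit alg_closure"
  assumes "x ^ (2 ^ n) = y ^ (2 ^ n)"
  shows "x = y"
proof -
  have "(x + y) ^ (2 ^ n) = x ^ (2 ^ n) + - (x ^ (2 ^ n))"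
    using assms minus_ac[of "x ^ (2 ^ n)"] by (simp add: frobenius_add)
  then have "x + y = 0" by simp
  then show ?thesis by (metis minus_ac add_eq_0_iff)
qed

text \<open>For \<open>n \<ge> 1\<close> the field with \<open>2 ^ n\<close> elements, as fixed
  points of a Frobenius power. Inside one algebraic closure a field and its subfield share a type,
  so the norm needs no embeddings.\<close>

definition galois :: "nat \<Rightarrow> bit alg_closure set" where
  "galois n = {z. z ^ (2 ^ n) = z}"

text \<open>X^(2^n) - X has derivative -1 in characteristic 2, hence no multiple roots. It splits
  over the algebraic closure, so it has as many roots as its degree.\<close>

lemma card_galois:
  assumes "n \<ge> 1"
  shows "card (galois n) = 2 ^ n" "finite (galois n)"
proof -
  define p :: "bit alg_closure poly" where "p = monom 1 (2 ^ n) - monom 1 1"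
  have two: "(2::nat) ^ n > 1" by (rule one_less_power) (use assms in auto)
  have "degree (monom (1 :: bit alg_closure) 1) < degree (monom (1 :: bit alg_closure) (2 ^ n))"
    using two by (simp add: degree_monom_eq)
  then have dp: "degree p = 2 ^ n"
    unfolding p_def using degree_add_eq_left[of "- monom 1 1" "monom (1 :: bit alg_closure) (2 ^ n)"]
    by (simp add: degree_monom_eq)
  then have "p \<noteq> 0" by auto
  have roots: "poly p z = 0 \<longleftrightarrow> z \<in> galois n" for z
    by (simp add: p_def poly_monom galois_def)
  have "of_nat (2 ^ n) = (0 :: bit alg_closure)" using assms by (simp add: two_ac)
  then have "pderiv (monom (1 :: bit alg_closure) (2 ^ n)) = 0"
    unfolding pderiv_monom by (simp only: mult_1_right monom_eq_0)
  then have "pderiv p = 0 - pderiv (monom 1 1)" by (simp only: p_def pderiv_diff)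
  then have p': "poly (pderiv p) z = - 1" for z by (simp add: pderiv_monom)
  obtain A where A: "size A = degree p" "p = smult (lead_coeff p) (\<Prod>x\<in>#A. [:-x, 1:])"
    using alg_closed_imp_factorization[OF \<open>p \<noteq> 0\<close>] by blast
  have "poly p z = 0 \<longleftrightarrow> z \<in># A" for z
    by (subst A(2)) (use \<open>p \<noteq> 0\<close> in \<open>auto simp: poly_prod_mset prod_mset_zero_iff\<close>)
  then have set_A: "set_mset A = galois n" using roots by auto
  have "count A r = 1" if "r \<in># A" for r
  proof (rule ccontr)
    assume "count A r \<noteq> 1"
    moreover have "count A r \<noteq> 0" using that by simp
    ultimately have "2 \<le> count A r" by linarith
    then have "replicate_mset 2 r \<subseteq># A" by (simp only: count_le_replicate_mset_subset_eq)
    then obtain A' where A': "A = replicate_mset 2 r + A'"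
      unfolding mset_subset_eq_exists_conv by blast
    have "p = [:-r, 1:] * ([:-r, 1:] * smult (lead_coeff p) (\<Prod>x\<in>#A'. [:-x, 1:]))"
      using A(2) unfolding A' by (simp only: numeral_2_eq_2 replicate_mset_Suc replicate_mset_0
        union_mset_add_mset_left empty_neutral image_mset_add_mset prod_mset.add_mset mult_smult_right)
    then obtain g where g: "p = [:-r, 1:] * ([:-r, 1:] * g)" by blast
    have "poly (pderiv p) r = 0" unfolding g pderiv_mult poly_add poly_mult by simp
    then show False using p'[of r] by simp
  qed
  then have "size A = card (set_mset A)"
    by (simp add: size_multiset_overloaded_eq)
  then show "card (galois n) = 2 ^ n" "finite (galois n)"
    using A(1) dp set_A finite_set_mset[of A] by auto
qed

lemma norm_graph_coloring:
  assumes d: "d \<ge> 1" and k: "k \<ge> 1"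
  shows "\<exists>\<chi> :: nat \<Rightarrow> nat \<Rightarrow> nat. (\<forall>u v. \<chi> u v = \<chi> v u) \<and>
    (\<forall>u < 2 ^ (k * d). \<forall>v < 2 ^ (k * d). \<chi> u v < 2 ^ k) \<and>
    (\<forall>U W c. U \<subseteq> {..<2 ^ (k * d)} \<longrightarrow> W \<subseteq> {..<2 ^ (k * d)} \<longrightarrow> card U = d \<longrightarrow>
       (\<forall>u\<in>U. \<forall>w\<in>W. \<chi> u w = c) \<longrightarrow> card W \<le> (d * (d + 3)) ^ d)"
proof -
  define N where "N = (2 :: nat) ^ (k * d)"
  define L where "L = galois (k * d)"
  have kd: "k * d \<ge> 1" using d k by simp
  obtain f where f: "bij_betw f {..<N} L"
    using card_galois[OF kd] ex_bij_betw_nat_finite[of L]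
    by (auto simp: L_def N_def atLeast0LessThan)
  obtain h where h: "bij_betw h (galois k) {..<(2::nat) ^ k}"
    using card_galois[OF k] ex_bij_betw_finite_nat[of "galois k"] by (auto simp: atLeast0LessThan)
  \<comment> \<open>The field norm from \<open>L\<close> to \<open>galois k\<close>: the product of
    the \<open>d\<close> conjugates.\<close>
  define nrm :: "bit alg_closure \<Rightarrow> bit alg_closure" where "nrm z = (\<Prod>i<d. z ^ (2 ^ (k * i)))" for z
  have nrm: "nrm z \<in> galois k" if "z \<in> L" for z
  proof -
    have "nrm z ^ (2 ^ k) = (\<Prod>i<d. z ^ (2 ^ (k * Suc i)))"
      by (simp add: nrm_def prod_power_distrib power_mult[symmetric] power_add algebra_simps)
    \<comment> \<open>Raising to the power \<open>2 ^ k\<close> shifts the conjugates, and the last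
      one returns to \<open>z\<close>. The extra factor \<open>z\<close> is cancelled afterwards,
      which leaves \<open>z = 0\<close> as a case of its own.\<close>
    also have "z ^ (2 ^ (k * 0)) * \<dots> = (\<Prod>i<Suc d. z ^ (2 ^ (k * i)))"
      by (simp only: prod.lessThan_Suc_shift o_def)
    also have "\<dots> = nrm z * z ^ (2 ^ (k * d))" by (simp add: nrm_def)
    also have "z ^ (2 ^ (k * d)) = z" using that by (simp add: L_def galois_def)
    finally have "z * nrm z ^ (2 ^ k) = z * nrm z" by (simp add: mult.commute)
    moreover have "nrm 0 ^ (2 ^ k) = nrm 0" using d by (simp add: nrm_def zero_power)
    ultimately show ?thesis by (cases "z = 0") (auto simp: galois_def)
  qed
  define \<chi> where "\<chi> u v = h (nrm (f u + f v))" for u v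
  have L: "f u \<in> L" if "u < N" for u using f that by (auto simp: bij_betw_def)
  have L_add: "f u + f v \<in> L" if "u < N" "v < N" for u v
    using L[OF that(1)] L[OF that(2)] by (simp add: L_def galois_def frobenius_add)
  have "card W \<le> (d * (d + 3)) ^ d"
    if U: "U \<subseteq> {..<N}" "card U = d" and W: "W \<subseteq> {..<N}" and c: "\<And>u w. u \<in> U \<Longrightarrow> w \<in> W \<Longrightarrow> \<chi> u w = c" for U W c
  proof (cases "W = {}")
    case False
    then obtain w0 where w0: "w0 \<in> W" by auto
    obtain g where g: "bij_betw g {..<d} U"
      using U ex_bij_betw_nat_finite[of U] finite_subset[OF U(1)] by (auto simp: atLeast0LessThan)
    have gU: "g j \<in> U" if "j < d" for j using g that by (auto simp: bij_betw_def)
    then have gN: "g j < N" if "j < d" for j using U that by blast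
    \<comment> \<open>A fixed \<open>w0\<close> names the norm for each \<open>j\<close>: equal
      colors mean equal norms, since \<open>h\<close> is injective on
      \<open>galois k\<close>.\<close>
    define b where "b j = nrm (f (g j) + f w0)" for j
    have finj: "inj_on f {..<N}" using f by (simp add: bij_betw_def)
    show ?thesis
    proof (rule card_solutions_le[where x = "\<lambda>i w. f w ^ (2 ^ (k * i))" and b = b
          and a = "\<lambda>i j. f (g j) ^ (2 ^ (k * i))" and S = W])
      fix w j assume w: "w \<in> W" and j: "j < d"
      have wN: "w < N" "w0 < N" using w w0 W by auto
      have "h (nrm (f (g j) + f w)) = h (nrm (f (g j) + f w0))"
        using c[OF gU[OF j] w] c[OF gU[OF j] w0] by (simp add: \<chi>_def)
      then have "nrm (f (g j) + f w) = b j"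
        using h nrm[OF L_add[OF gN[OF j] wN(1)]] nrm[OF L_add[OF gN[OF j] wN(2)]]
        by (auto simp: bij_betw_def b_def dest: inj_onD)
      moreover have "f w ^ (2 ^ (k * i)) - f (g j) ^ (2 ^ (k * i)) = (f (g j) + f w) ^ (2 ^ (k * i))" for i
        by (metis add.commute frobenius_add minus_ac diff_conv_add_uminus)
      ultimately show "(\<Prod>i<d. f w ^ (2 ^ (k * i)) - f (g j) ^ (2 ^ (k * i))) = b j"
        by (simp add: nrm_def)
    next
      fix i
      show "inj_on (\<lambda>j. f (g j) ^ (2 ^ (k * i))) {..<d}"
      proof (rule inj_onI)
        fix j j' assume j: "j \<in> {..<d}" "j' \<in> {..<d}" "f (g j) ^ (2 ^ (k * i)) = f (g j') ^ (2 ^ (k * i))"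
        from j(3) have "f (g j) = f (g j')" by (rule frobenius_inj)
        then have "g j = g j'" by (rule inj_onD[OF finj]) (use gN j in auto)
        then show "j = j'" using j(1,2) by (rule inj_onD[OF bij_betw_imp_inj_on[OF g]])
      qed
    next
      show "inj_on (\<lambda>w. f w ^ (2 ^ (k * 0))) W" using inj_on_subset[OF finj W] by simp
      show "finite W" using W finite_subset by blast
      show "0 < d" using d by simp
    qed
  qed simp
  moreover have "\<chi> u v < 2 ^ k" if "u < N" "v < N" for u v
    using nrm[OF L_add[OF that]] h by (auto simp: \<chi>_def bij_betw_def)
  moreover have "\<chi> u v = \<chi> v u" for u v by (simp add: \<chi>_def add.commute)
  ultimately show ?thesis by (intro exI[of _ \<chi>]) (auto simp: N_def)
qed

section \<open>Dense bipartite graphs without large bicliques\<close>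

definition biclique_free :: "nat \<Rightarrow> ('p \<times> 'q) set \<Rightarrow> bool" where
  "biclique_free k R \<longleftrightarrow> (\<forall>Y Z. card Y = k \<longrightarrow> card Z = k \<longrightarrow> \<not> Y \<times> Z \<subseteq> R)"

text \<open>Counting over all subsets of \<open>P \<times> Q\<close>. At most 2^(2lk) pairs of
  k-sets compete, and each lies in a fraction 2^(-k^2) of the subsets; for k = 2l + 2 the exponent
  k^2 = 2lk + 2k leaves at most a quarter with a biclique. At most half are sparse, because
  complements of sparse sets are not sparse.\<close>

lemma exists_dense_biclique_free:
  fixes P :: "'p set" and Q :: "'q set"
  assumes fin: "finite P" "finite Q" and card: "card P = 2 ^ l" "card Q = 2 ^ l"
  shows "\<exists>R\<subseteq>P \<times> Q. card (P \<times> Q) \<le> 2 * card R \<and> biclique_free (2 * l + 2) R"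
proof -
  define n where "n = card (P \<times> Q)"
  define k where "k = 2 * l + 2"
  define \<Omega> where "\<Omega> = Pow (P \<times> Q)"
  have fin\<Omega>: "finite \<Omega>" and card\<Omega>: "card \<Omega> = 2 ^ n"
    using fin by (simp_all add: \<Omega>_def n_def card_Pow)
  define pairs where "pairs = {Y. Y \<subseteq> P \<and> card Y = k} \<times> {Z. Z \<subseteq> Q \<and> card Z = k}"
  define H where "H = (\<lambda>(Y, Z). {R\<in>\<Omega>. Y \<times> Z \<subseteq> R})"
  define Sp where "Sp = {R\<in>\<Omega>. 2 * card R < n}"
  have fin_pairs: "finite pairs" using fin by (auto simp: pairs_def)
  have "card pairs = (2 ^ l choose k) * (2 ^ l choose k)"
    using fin by (simp add: pairs_def card_cartesian_product n_subsets card)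
  also have "\<dots> \<le> 2 ^ (l * k) * 2 ^ (l * k)"
  proof -
    have "(2 ^ l choose k) \<le> 2 ^ (l * k)"
      by (cases "k \<le> 2 ^ l") (simp_all add: binomial_le_pow power_mult binomial_eq_0)
    then show ?thesis by (intro mult_mono) auto
  qed
  finally have cp: "card pairs \<le> 2 ^ (2 * l * k)"
    by (simp add: power_add[symmetric] mult_2 distrib_right)
  have H: "4 * (2 ^ (2 * l * k) * card (H p)) \<le> 2 ^ n" if p: "p \<in> pairs" for p
  proof -
    obtain Y Z where YZ: "p = (Y, Z)" "Y \<subseteq> P" "Z \<subseteq> Q" "card Y = k" "card Z = k"
      using p by (auto simp: pairs_def)
    have sub: "Y \<times> Z \<subseteq> P \<times> Q" using YZ by auto
    have cYZ: "card (Y \<times> Z) = k * k" using YZ by (simp add: card_cartesian_product)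
    then have kn: "k * k \<le> n" using card_mono[OF _ sub] fin by (simp add: n_def)
    have "card (H p) \<le> card (Pow (P \<times> Q - Y \<times> Z))"
    proof (rule card_inj_on_le)
      show "inj_on (\<lambda>R. R - Y \<times> Z) (H p)" by (auto simp: H_def YZ inj_on_def)
      show "(\<lambda>R. R - Y \<times> Z) ` H p \<subseteq> Pow (P \<times> Q - Y \<times> Z)" by (auto simp: H_def \<Omega>_def YZ)
    qed (use fin in auto)
    also have "\<dots> = 2 ^ (n - k * k)"
      using fin sub cYZ finite_subset[OF sub] by (simp add: card_Pow card_Diff_subset n_def)
    finally have "4 * (2 ^ (2 * l * k) * card (H p)) \<le> 2 ^ 2 * (2 ^ (2 * l * k) * 2 ^ (n - k * k))" by simp
    also have "\<dots> = 2 ^ (2 + 2 * l * k + (n - k * k))" by (simp add: power_add)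
    also have "\<dots> \<le> 2 ^ n"
    proof (rule power_increasing)
      have "k * k = 2 * l * k + 2 * k" by (simp add: k_def algebra_simps)
      moreover have "k \<ge> 2" by (simp add: k_def)
      ultimately show "2 + 2 * l * k + (n - k * k) \<le> n" using kn by linarith
    qed simp
    finally show ?thesis .
  qed
  have UN: "4 * card (\<Union>p\<in>pairs. H p) \<le> 2 ^ n"
  proof (cases "pairs = {}")
    case False
    have "2 ^ (2 * l * k) * (4 * card (\<Union>p\<in>pairs. H p)) \<le> 2 ^ (2 * l * k) * (4 * (\<Sum>p\<in>pairs. card (H p)))"
      using card_UN_le[OF fin_pairs, of H] by simp
    also have "\<dots> = (\<Sum>p\<in>pairs. 4 * (2 ^ (2 * l * k) * card (H p)))"
      unfolding sum_distrib_left by (rule sum.cong) (simp_all add: mult_ac)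
    also have "\<dots> \<le> card pairs * 2 ^ n" using sum_bounded_above[of pairs, OF H] by simp
    also have "\<dots> \<le> 2 ^ (2 * l * k) * 2 ^ n" using cp by (rule mult_right_mono) simp
    finally show ?thesis by simp
  qed simp
  have Sp: "2 * card Sp \<le> 2 ^ n"
  proof -
    define C where "C = (\<lambda>R. P \<times> Q - R) ` Sp"
    have inj: "inj_on (\<lambda>R. P \<times> Q - R) Sp"
      by (rule inj_onI) (auto simp: Sp_def \<Omega>_def)
    have "Sp \<inter> C = {}"
    proof -
      have False if "R \<in> Sp" "R' \<in> Sp" "R = P \<times> Q - R'" for R R'
      proof -
        have "card R = n - card R'"
          using that fin finite_subset[of R' "P \<times> Q"]
          by (simp add: n_def Sp_def \<Omega>_def card_Diff_subset)
        moreover have "2 * card R < n" "2 * card R' < n" using that(1,2) by (simp_all add: Sp_def)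
        ultimately show False by linarith
      qed
      then show ?thesis by (auto simp: C_def)
    qed
    moreover have "Sp \<union> C \<subseteq> \<Omega>" by (auto simp: Sp_def C_def \<Omega>_def)
    moreover have "finite Sp" "finite C" using fin\<Omega> by (auto simp: Sp_def C_def)
    ultimately have "card Sp + card C \<le> card \<Omega>"
      using card_Un_disjoint[of Sp C] card_mono[OF fin\<Omega>] by metis
    then show ?thesis using card_image[OF inj] by (simp add: C_def card\<Omega>)
  qed
  have "0 < (2 :: nat) ^ n" by simp
  then have less: "card ((\<Union>p\<in>pairs. H p) \<union> Sp) < card \<Omega>"
    using card_Un_le[of "\<Union>p\<in>pairs. H p" Sp] UN Sp unfolding card\<Omega> by linarith
  have "(\<Union>p\<in>pairs. H p) \<union> Sp \<subseteq> \<Omega>" by (auto simp: H_def Sp_def)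
  then have "finite ((\<Union>p\<in>pairs. H p) \<union> Sp)" using fin\<Omega> by (rule finite_subset)
  then have "\<not> \<Omega> \<subseteq> (\<Union>p\<in>pairs. H p) \<union> Sp" using less card_mono leD by blast
  then obtain R where R: "R \<in> \<Omega>" "R \<notin> (\<Union>p\<in>pairs. H p)" "R \<notin> Sp" by blast
  have "biclique_free k R"
    unfolding biclique_free_def
  proof (intro allI impI notI)
    fix Y Z assume YZ: "card Y = k" "card Z = k" "Y \<times> Z \<subseteq> R"
    then have "Y \<noteq> {}" "Z \<noteq> {}" by (auto simp: k_def)
    then have "Y \<subseteq> P" "Z \<subseteq> Q" using YZ R(1) by (auto simp: \<Omega>_def)
    then have "R \<in> (\<Union>p\<in>pairs. H p)"
      using YZ R(1) by (auto simp: pairs_def H_def intro!: bexI[of _ "(Y, Z)"])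
    then show False using R by simp
  qed
  then show ?thesis using R by (intro exI[of _ R]) (auto simp: \<Omega>_def Sp_def n_def k_def)
qed

text \<open>Any \<open>k\<close> exceptional vertices have together at most \<open>k * v\<close>
  non-neighbors in \<open>Z\<close>, so at least \<open>k * v\<close> vertices of \<open>Z\<close>
  are joined to all of them, a biclique. It serves to keep a fraction 1/(2k) of the candidates at
  each required non-adjacency.\<close>

lemma biclique_free_expansion:
  assumes R: "biclique_free k R" and k: "k \<ge> 1" and v: "v \<ge> 1"
    and fin: "finite Y" "finite Z" and Z: "2 * k * v \<le> card Z"
    and Y: "\<And>y. y \<in> Y \<Longrightarrow> card {z\<in>Z. (z, y) \<notin> R} < v"
  shows "card Y \<le> k"
proof (rule ccontr)
  assume "\<not> card Y \<le> k"
  then obtain Y' where Y': "Y' \<subseteq> Y" "card Y' = k"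
    by (meson nle_le obtain_subset_with_card_n)
  define W where "W = (\<Union>y\<in>Y'. {z\<in>Z. (z, y) \<notin> R})"
  have finY': "finite Y'" using Y' fin finite_subset by blast
  have "card W \<le> (\<Sum>y\<in>Y'. card {z\<in>Z. (z, y) \<notin> R})"
    unfolding W_def by (rule card_UN_le) (use finY' in auto)
  also have "\<dots> \<le> card Y' * v" using sum_bounded_above[of Y' "\<lambda>y. card {z\<in>Z. (z, y) \<notin> R}" v] Y Y' by (simp add: less_imp_le subset_iff)
  finally have cW: "card W \<le> k * v" by (simp add: Y')
  have "finite W" "W \<subseteq> Z" using fin by (auto simp: W_def intro: finite_subset)
  then have "card (Z - W) = card Z - card W" by (simp add: card_Diff_subset)
  also have "\<dots> \<ge> k * v" using Z cW by simp
  finally have "k * v \<le> card (Z - W)" .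
  moreover have "k * 1 \<le> k * v" using v by (intro mult_le_mono2)
  ultimately have "k \<le> card (Z - W)" by linarith
  then obtain Z' where Z': "Z' \<subseteq> Z - W" "card Z' = k" by (meson obtain_subset_with_card_n)
  then have "Z' \<times> Y' \<subseteq> R" by (auto simp: W_def)
  then show False using R Y' Z' by (auto simp: biclique_free_def)
qed

section \<open>Failure counts for random maps\<close>

text \<open>Conditioning on all coordinates except \<open>b\<close>: a random map fails with
  probability at most \<open>k / card U\<close>.\<close>

lemma card_PiE_one_coordinate_le:
  assumes fin: "finite B" "finite U" and b: "b \<in> B"
    and k: "\<And>\<beta>. \<beta> \<in> B \<rightarrow>\<^sub>E U \<Longrightarrow> card {y\<in>U. Pr (\<beta>(b := y))} \<le> k"
  shows "card {\<beta> \<in> B \<rightarrow>\<^sub>E U. Pr \<beta>} \<le> k * card U ^ (card B - 1)"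
proof -
  let ?G = "(B - {b}) \<rightarrow>\<^sub>E U"
  let ?S = "Sigma ?G (\<lambda>\<gamma>. {y\<in>U. Pr (\<gamma>(b := y))})"
  have finG: "finite ?G" using fin by (intro finite_PiE) auto
  have "card {\<beta> \<in> B \<rightarrow>\<^sub>E U. Pr \<beta>} \<le> card ?S"
  proof (rule card_inj_on_le)
    let ?f = "\<lambda>\<beta>. (\<beta>(b := undefined), \<beta> b)"
    show "inj_on ?f {\<beta> \<in> B \<rightarrow>\<^sub>E U. Pr \<beta>}"
    proof (rule inj_onI)
      fix \<beta> \<beta>' assume "?f \<beta> = ?f \<beta>'"
      then have "(\<beta>(b := undefined))(b := \<beta> b) = (\<beta>'(b := undefined))(b := \<beta>' b)" by simp
      then show "\<beta> = \<beta>'" by simp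
    qed
    show "?f ` {\<beta> \<in> B \<rightarrow>\<^sub>E U. Pr \<beta>} \<subseteq> ?S"
      using b by (auto simp: PiE_def extensional_def split: if_splits)
    show "finite ?S" using finG fin by auto
  qed
  also have "\<dots> = (\<Sum>\<gamma>\<in>?G. card {y\<in>U. Pr (\<gamma>(b := y))})"
    using finG fin by (simp add: card_SigmaI)
  also have "\<dots> \<le> (\<Sum>\<gamma>\<in>?G. k)"
  proof (rule sum_mono)
    fix \<gamma> assume g: "\<gamma> \<in> ?G"
    show "card {y\<in>U. Pr (\<gamma>(b := y))} \<le> k"
    proof (cases "U = {}")
      case False
      then obtain u where "u \<in> U" by auto
      then have "\<gamma>(b := u) \<in> B \<rightarrow>\<^sub>E U" using g b by (auto simp: PiE_def extensional_def)
      from k[OF this] show ?thesis by simp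
    qed simp
  qed
  also have "\<dots> = k * card U ^ (card B - 1)"
    using fin b by (simp add: card_PiE)
  finally show ?thesis .
qed

text \<open>Coordinates outside the image of \<open>g\<close> are free, so a failure rate for tuples
  indexed by \<open>J\<close> passes to random maps on \<open>B\<close>.\<close>

lemma card_PiE_restrict_le:
  assumes fin: "finite B" "finite U" and g: "inj_on g J" "g ` J \<subseteq> B"
  shows "card {\<beta> \<in> B \<rightarrow>\<^sub>E U. Pr (restrict (\<beta> \<circ> g) J)} \<le>
         card {\<gamma> \<in> J \<rightarrow>\<^sub>E U. Pr \<gamma>} * card U ^ (card B - card J)"
proof -
  have finJ: "finite J" using g fin by (meson finite_imageD finite_subset)
  have "card {\<beta> \<in> B \<rightarrow>\<^sub>E U. Pr (restrict (\<beta> \<circ> g) J)} \<le>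
        card ({\<gamma> \<in> J \<rightarrow>\<^sub>E U. Pr \<gamma>} \<times> ((B - g ` J) \<rightarrow>\<^sub>E U))"
  proof (rule card_inj_on_le)
    let ?f = "\<lambda>\<beta>. (restrict (\<beta> \<circ> g) J, restrict \<beta> (B - g ` J))"
    show "inj_on ?f {\<beta> \<in> B \<rightarrow>\<^sub>E U. Pr (restrict (\<beta> \<circ> g) J)}"
    proof (rule inj_onI)
      fix \<beta> \<beta>' assume b: "\<beta> \<in> {\<beta> \<in> B \<rightarrow>\<^sub>E U. Pr (restrict (\<beta> \<circ> g) J)}"
        "\<beta>' \<in> {\<beta> \<in> B \<rightarrow>\<^sub>E U. Pr (restrict (\<beta> \<circ> g) J)}" "?f \<beta> = ?f \<beta>'"
      then have 1: "restrict (\<beta> \<circ> g) J j = restrict (\<beta>' \<circ> g) J j"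
        and 2: "restrict \<beta> (B - g ` J) y = restrict \<beta>' (B - g ` J) y" for j y by simp_all
      show "\<beta> = \<beta>'"
      proof (rule PiE_ext)
        show "\<beta> \<in> B \<rightarrow>\<^sub>E U" "\<beta>' \<in> B \<rightarrow>\<^sub>E U" using b by auto
        fix y assume "y \<in> B"
        show "\<beta> y = \<beta>' y"
        proof (cases "y \<in> g ` J")
          case True
          then obtain j where "j \<in> J" "y = g j" by auto
          then show ?thesis using 1[of j] by simp
        next
          case False
          then show ?thesis using 2[of y] \<open>y \<in> B\<close> by simp
        qed
      qed
    qed
    show "?f ` {\<beta> \<in> B \<rightarrow>\<^sub>E U. Pr (restrict (\<beta> \<circ> g) J)} \<subseteq>
      {\<gamma> \<in> J \<rightarrow>\<^sub>E U. Pr \<gamma>} \<times> ((B - g ` J) \<rightarrow>\<^sub>E U)"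
    proof (rule image_subsetI)
      fix \<beta> assume b: "\<beta> \<in> {\<beta> \<in> B \<rightarrow>\<^sub>E U. Pr (restrict (\<beta> \<circ> g) J)}"
      then have "\<beta> y \<in> U" if "y \<in> B" for y using that by (auto simp: PiE_iff)
      then have "\<beta> (g j) \<in> U" if "j \<in> J" for j using that g(2) by auto
      moreover have "\<beta> y \<in> U" if "y \<in> B - g ` J" for y using that b by (auto simp: PiE_iff)
      ultimately show "?f \<beta> \<in> {\<gamma> \<in> J \<rightarrow>\<^sub>E U. Pr \<gamma>} \<times> ((B - g ` J) \<rightarrow>\<^sub>E U)"
        using b by (simp add: restrict_PiE_iff)
    qed
    show "finite ({\<gamma> \<in> J \<rightarrow>\<^sub>E U. Pr \<gamma>} \<times> ((B - g ` J) \<rightarrow>\<^sub>E U))"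
      using fin finJ by (intro finite_cartesian_product finite_Collect_conjI disjI1) (auto simp: finite_PiE)
  qed
  also have "\<dots> = card {\<gamma> \<in> J \<rightarrow>\<^sub>E U. Pr \<gamma>} * card U ^ (card B - card J)"
    using fin g finJ by (simp add: card_cartesian_product card_PiE card_Diff_subset card_image)
  finally show ?thesis .
qed

section \<open>Dependent random choice\<close>

lemma double_counting:
  assumes "finite A" "finite B"
  shows "(\<Sum>a\<in>A. card {b\<in>B. r a b}) = (\<Sum>b\<in>B. card {a\<in>A. r a b})"
  using sum.swap_restrict[OF assms, of "\<lambda>_ _. 1 :: nat" r] by simp

lemma power_tangent_le:
  fixes x a :: real
  assumes "x \<ge> 0" "a \<ge> 0"
  shows "a ^ Suc n + real (Suc n) * a ^ n * (x - a) \<le> x ^ Suc n"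
proof (induction n)
  case (Suc n)
  have "a ^ Suc (Suc n) + real (Suc (Suc n)) * a ^ Suc n * (x - a) \<le>
        x * (a ^ Suc n + real (Suc n) * a ^ n * (x - a))"
  proof -
    have "x * (a ^ Suc n + real (Suc n) * a ^ n * (x - a)) -
      (a ^ Suc (Suc n) + real (Suc (Suc n)) * a ^ Suc n * (x - a)) = real (Suc n) * a ^ n * (x - a) ^ 2"
      by (simp add: algebra_simps power2_eq_square)
    also have "\<dots> \<ge> 0" using assms by simp
    finally show ?thesis by simp
  qed
  also have "\<dots> \<le> x * x ^ Suc n" using Suc assms by (intro mult_left_mono)
  finally show ?case by simp
qed simp

text \<open>Jensen for powers, by summing the tangents at \<open>a\<close>. Their slope is
  nonnegative, so \<open>a\<close> may lie below the average.\<close>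

lemma sum_power_ge_average:
  fixes x :: "'i \<Rightarrow> real" and a :: real
  assumes "finite I" "\<And>i. i \<in> I \<Longrightarrow> x i \<ge> 0" "a \<ge> 0" "card I * a \<le> (\<Sum>i\<in>I. x i)" "n \<ge> 1"
  shows "card I * a ^ n \<le> (\<Sum>i\<in>I. x i ^ n)"
proof -
  obtain n' where n: "n = Suc n'" using assms(5) by (cases n) auto
  have "card I * a ^ n \<le> card I * a ^ n + real n * a ^ n' * ((\<Sum>i\<in>I. x i) - card I * a)"
    using assms by simp
  also have "\<dots> = (\<Sum>i\<in>I. a ^ n + real n * a ^ n' * (x i - a))"
    by (simp add: sum.distrib sum_distrib_left[symmetric] sum_subtractf)
  also have "\<dots> \<le> (\<Sum>i\<in>I. x i ^ n)"
    unfolding n by (intro sum_mono power_tangent_le assms)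
  finally show ?thesis .
qed

lemma power_superadditive:
  fixes a b :: nat
  assumes "n \<ge> 1"
  shows "a ^ n + b ^ n \<le> (a + b) ^ n"
  using assms
proof (induction n rule: dec_induct)
  case (step n)
  have "a ^ Suc n + b ^ Suc n \<le> (a + b) * (a ^ n + b ^ n)" by (simp add: algebra_simps)
  also have "\<dots> \<le> (a + b) * (a + b) ^ n" using step by (intro mult_le_mono2)
  finally show ?case by simp
qed simp

text \<open>A bound by a power of a nonnegative quantity, valid also for \<open>w < d\<close>, is
  what \<open>sum_power_ge_average\<close> can process. The price is the shift by
  \<open>d\<close>.\<close>

lemma binomial_ge_shifted_power:
  assumes "d \<ge> 1"
  shows "(max 0 ((real w - real d) / real d)) ^ d \<le> real (w choose d)"
proof (cases "d \<le> w")
  case True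
  then have "max 0 ((real w - real d) / real d) \<le> real w / real d"
    by (intro max.boundedI divide_right_mono) auto
  then have "(max 0 ((real w - real d) / real d)) ^ d \<le> (real w / real d) ^ d"
    by (intro power_mono) auto
  also have "\<dots> \<le> real (w choose d)" using binomial_ge_n_over_k_pow_k[OF True] .
  finally show ?thesis .
next
  case False
  then have "max 0 ((real w - real d) / real d) = 0" using assms by (auto simp: field_simps)
  then show ?thesis using assms by (simp add: zero_power)
qed

definition common_left :: "('p \<times> 'q) set \<Rightarrow> 'p set \<Rightarrow> 'q set \<Rightarrow> 'p set" where
  "common_left R P Y = {p\<in>P. \<forall>y\<in>Y. (p, y) \<in> R}"

definition common_right :: "('p \<times> 'q) set \<Rightarrow> 'q set \<Rightarrow> 'p set \<Rightarrow> 'q set" where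
  "common_right R Q T = {q\<in>Q. \<forall>p\<in>T. (p, q) \<in> R}"

text \<open>The sum counts each vertex of \<open>P\<close> with the \<open>d\<close>-tuples of its
  neighbors, so it is a sum of \<open>d\<close>-th powers of degrees, and convexity applies.\<close>

lemma sum_common_left_ge:
  fixes R :: "('p \<times> 'q) set" and \<delta> :: real
  assumes fin: "finite P" "finite Q" and R: "R \<subseteq> P \<times> Q" and d: "d \<ge> 1" and "\<delta> \<ge> 0"
    and dens: "\<delta> * card P * card Q \<le> card R"
  shows "card P * (\<delta> * card Q) ^ d \<le> (\<Sum>\<gamma>\<in>{..<d} \<rightarrow>\<^sub>E Q. card (common_left R P (\<gamma> ` {..<d})))"
proof -
  define nb where "nb p = {q\<in>Q. (p, q) \<in> R}" for p
  have finE: "finite ({..<d} \<rightarrow>\<^sub>E Q)" using fin by (intro finite_PiE) auto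
  have R_eq: "R = Sigma P nb" using R by (auto simp: nb_def)
  have "card (Sigma P nb) = (\<Sum>p\<in>P. card (nb p))"
    by (rule card_SigmaI) (use fin in \<open>auto simp: nb_def\<close>)
  then have "card R = (\<Sum>p\<in>P. card (nb p))" by (simp only: R_eq[symmetric])
  then have "card P * (\<delta> * card Q) \<le> (\<Sum>p\<in>P. real (card (nb p)))"
    using dens by (simp add: mult_ac)
  then have "card P * (\<delta> * card Q) ^ d \<le> (\<Sum>p\<in>P. real (card (nb p)) ^ d)"
    using fin d \<open>\<delta> \<ge> 0\<close> by (intro sum_power_ge_average) auto
  also have "\<dots> = real (\<Sum>p\<in>P. card (nb p) ^ d)" by simp
  also have "(\<Sum>p\<in>P. card (nb p) ^ d) =
      (\<Sum>p\<in>P. card {\<gamma>\<in>{..<d} \<rightarrow>\<^sub>E Q. \<forall>y\<in>\<gamma> ` {..<d}. (p, y) \<in> R})"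
  proof (rule sum.cong)
    fix p assume "p \<in> P"
    have "{\<gamma>\<in>{..<d} \<rightarrow>\<^sub>E Q. \<forall>y\<in>\<gamma> ` {..<d}. (p, y) \<in> R} = ({..<d} \<rightarrow>\<^sub>E nb p)"
      by (auto simp: nb_def PiE_def Pi_def)
    then show "card (nb p) ^ d = card {\<gamma>\<in>{..<d} \<rightarrow>\<^sub>E Q. \<forall>y\<in>\<gamma> ` {..<d}. (p, y) \<in> R}"
      by (simp add: card_PiE)
  qed simp
  also have "\<dots> = (\<Sum>\<gamma>\<in>{..<d} \<rightarrow>\<^sub>E Q. card (common_left R P (\<gamma> ` {..<d})))"
    unfolding common_left_def by (rule double_counting[OF fin(1) finE])
  finally show ?thesis .
qed

text \<open>Double counting of pairs of a \<open>d\<close>-set \<open>T\<close> and a tuple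
  \<open>\<gamma>\<close> completely joined by \<open>R\<close>. \<open>Pr\<close> is a parameter
  because both all tuples and the bad ones are counted this way.\<close>

lemma sum_choose_common_left:
  fixes R :: "('p \<times> 'q) set"
  assumes fin: "finite P" "finite Q"
  shows "(\<Sum>T | T \<subseteq> P \<and> card T = d. card {\<gamma>\<in>{..<d} \<rightarrow>\<^sub>E common_right R Q T. Pr \<gamma>}) =
    (\<Sum>\<gamma> | \<gamma> \<in> {..<d} \<rightarrow>\<^sub>E Q \<and> Pr \<gamma>. card (common_left R P (\<gamma> ` {..<d})) choose d)"
proof -
  let ?G = "{\<gamma>. \<gamma> \<in> {..<d} \<rightarrow>\<^sub>E Q \<and> Pr \<gamma>}"
  let ?r = "\<lambda>T \<gamma>. \<forall>j<d. \<forall>p\<in>T. (p, \<gamma> j) \<in> R"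
  have finE: "finite ({..<d} \<rightarrow>\<^sub>E Q)" using fin by (intro finite_PiE) auto
  have "(\<Sum>T | T \<subseteq> P \<and> card T = d. card {\<gamma>\<in>{..<d} \<rightarrow>\<^sub>E common_right R Q T. Pr \<gamma>}) =
        (\<Sum>T | T \<subseteq> P \<and> card T = d. card {\<gamma>\<in>?G. ?r T \<gamma>})"
    by (intro sum.cong arg_cong[of _ _ card]) (auto simp: common_right_def PiE_def Pi_def)
  also have "\<dots> = (\<Sum>\<gamma>\<in>?G. card {T \<in> {T. T \<subseteq> P \<and> card T = d}. ?r T \<gamma>})"
    by (rule double_counting) (use fin finE in auto)
  also have "\<dots> = (\<Sum>\<gamma>\<in>?G. card (common_left R P (\<gamma> ` {..<d})) choose d)"
  proof (rule sum.cong)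
    fix \<gamma>
    have "{T \<in> {T. T \<subseteq> P \<and> card T = d}. ?r T \<gamma>} =
          {T. T \<subseteq> common_left R P (\<gamma> ` {..<d}) \<and> card T = d}"
      by (auto simp: common_left_def)
    then show "card {T \<in> {T. T \<subseteq> P \<and> card T = d}. ?r T \<gamma>} =
        card (common_left R P (\<gamma> ` {..<d})) choose d"
      using fin by (simp add: n_subsets common_left_def)
  qed simp
  finally show ?thesis .
qed

text \<open>The average runs over \<open>d\<close>-subsets \<open>T\<close>, without repetition,
  since \<open>T\<close> must later receive up to \<open>d\<close> distinct vertices. If every
  \<open>T\<close> failed, each \<open>card (U T) ^ d\<close> would be at most
  \<open>2 * v * bad T + u0 ^ d\<close>. Bad tuples lie in at most \<open>M ^ d\<close> of the sets
  \<open>T\<close>, so the total would fall below what the density forces.\<close>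

lemma dependent_random_choice:
  fixes R :: "('p \<times> 'q) set" and \<delta> :: real
  assumes fin: "finite P" "finite Q" and card: "card P = N" "card Q = N"
    and R: "R \<subseteq> P \<times> Q" and d: "d \<ge> 1" and \<delta>: "\<delta> \<ge> 0" and v: "v \<ge> 1"
    and dens: "\<delta> * card P * card Q \<le> card R"
    and large: "real (d * (2 * v * M + u0 + 2)) \<le> N * \<delta> ^ d"
  shows "\<exists>T\<subseteq>P. card T = d \<and> u0 \<le> card (common_right R Q T) \<and>
    2 * v * card {\<gamma>\<in>{..<d} \<rightarrow>\<^sub>E common_right R Q T. card (common_left R P (\<gamma> ` {..<d})) < M}
      \<le> card (common_right R Q T) ^ d"
proof (rule ccontr)
  assume neg: "\<not> ?thesis"
  define U where "U T = common_right R Q T" for T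
  define w where "w \<gamma> = card (common_left R P (\<gamma> ` {..<d}))" for \<gamma> :: "nat \<Rightarrow> 'q"
  define E where "E = ({..<d} \<rightarrow>\<^sub>E Q)"
  define F where "F = {T. T \<subseteq> P \<and> card T = d}"
  define bad where "bad T = card {\<gamma>\<in>{..<d} \<rightarrow>\<^sub>E U T. w \<gamma> < M}" for T
  \<comment> \<open>Chosen so that \<open>a ^ d\<close> exceeds
    \<open>2 * v * M ^ d + u0 ^ d\<close>. The further 1 in \<open>d * (a + 1)\<close> makes up for
    the shift by \<open>d\<close> in the binomial bound.\<close>
  define a where "a = real (2 * v * M + u0 + 1)"
  have finE: "finite E" and cE: "card E = N ^ d"
    using fin card by (auto simp: E_def card_PiE intro!: finite_PiE)
  have "real (N ^ d) * (d * (a + 1)) \<le> real (N ^ d) * (N * \<delta> ^ d)"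
    using large by (intro mult_left_mono) (auto simp: a_def algebra_simps)
  also have "\<dots> = card P * (\<delta> * card Q) ^ d" by (simp add: card power_mult_distrib mult_ac)
  also have "\<dots> \<le> (\<Sum>\<gamma>\<in>E. w \<gamma>)"
    using sum_common_left_ge[OF fin R d \<delta> dens] by (simp add: E_def w_def)
  finally have sw: "real (N ^ d) * (d * (a + 1)) \<le> (\<Sum>\<gamma>\<in>E. w \<gamma>)" .
  have "card E * a \<le> (\<Sum>\<gamma>\<in>E. max 0 ((real (w \<gamma>) - real d) / real d))"
  proof -
    have "card E * a = (real (N ^ d) * (d * (a + 1)) - real (N ^ d * d)) / d"
      using d by (simp add: cE field_simps)
    also have "\<dots> \<le> ((\<Sum>\<gamma>\<in>E. real (w \<gamma>)) - real (N ^ d * d)) / d"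
      using sw d by (intro divide_right_mono) auto
    also have "\<dots> = (\<Sum>\<gamma>\<in>E. (real (w \<gamma>) - real d) / real d)"
      by (simp add: sum_divide_distrib[symmetric] sum_subtractf cE)
    also have "\<dots> \<le> (\<Sum>\<gamma>\<in>E. max 0 ((real (w \<gamma>) - real d) / real d))"
      by (intro sum_mono) auto
    finally show ?thesis .
  qed
  then have "card E * a ^ d \<le> (\<Sum>\<gamma>\<in>E. (max 0 ((real (w \<gamma>) - real d) / real d)) ^ d)"
    using finE d by (intro sum_power_ge_average) (auto simp: a_def)
  also have "\<dots> \<le> (\<Sum>\<gamma>\<in>E. real (w \<gamma> choose d))"
    by (intro sum_mono binomial_ge_shifted_power d)
  finally have "real (N ^ d * (2 * v * M + u0 + 1) ^ d) \<le> real (\<Sum>\<gamma>\<in>E. w \<gamma> choose d)"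
    by (simp add: cE a_def)
  then have lower: "N ^ d * (2 * v * M + u0 + 1) ^ d \<le> (\<Sum>\<gamma>\<in>E. w \<gamma> choose d)"
    by (simp only: of_nat_le_iff)
  also have "\<dots> = (\<Sum>T\<in>F. card (U T) ^ d)"
    using sum_choose_common_left[OF fin, where d = d and R = R and Pr = "\<lambda>_. True"]
    by (simp add: E_def F_def U_def w_def card_PiE)
  also have "\<dots> \<le> (\<Sum>T\<in>F. 2 * v * bad T + u0 ^ d)"
  proof (rule sum_mono)
    fix T assume "T \<in> F"
    then have "\<not> u0 \<le> card (U T) \<or> \<not> 2 * v * bad T \<le> card (U T) ^ d"
      using neg by (auto simp: F_def U_def bad_def w_def)
    then show "card (U T) ^ d \<le> 2 * v * bad T + u0 ^ d"
    proof
      assume "\<not> u0 \<le> card (U T)"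
      then have "card (U T) ^ d \<le> u0 ^ d" by (intro power_mono) auto
      then show ?thesis by simp
    qed simp
  qed
  also have "\<dots> = 2 * v * (\<Sum>T\<in>F. bad T) + (N choose d) * u0 ^ d"
    using fin by (simp add: sum.distrib sum_distrib_left F_def n_subsets card)
  also have "(\<Sum>T\<in>F. bad T) = (\<Sum>\<gamma> | \<gamma> \<in> E \<and> w \<gamma> < M. w \<gamma> choose d)"
    unfolding bad_def F_def U_def E_def w_def by (rule sum_choose_common_left[OF fin])
  also have "\<dots> \<le> (\<Sum>\<gamma> | \<gamma> \<in> E \<and> w \<gamma> < M. M ^ d)"
  proof (rule sum_mono)
    fix \<gamma> assume "\<gamma> \<in> {\<gamma>. \<gamma> \<in> E \<and> w \<gamma> < M}"
    then have "w \<gamma> ^ d \<le> M ^ d" by (intro power_mono) auto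
    then show "w \<gamma> choose d \<le> M ^ d"
      by (cases "d \<le> w \<gamma>") (auto intro: order.trans[OF binomial_le_pow] simp: binomial_eq_0)
  qed
  also have "\<dots> \<le> N ^ d * M ^ d"
    using card_mono[OF finE, of "{\<gamma>. \<gamma> \<in> E \<and> w \<gamma> < M}"] by (simp add: cE)
  also have "N choose d \<le> N ^ d" by (cases "d \<le> N") (simp_all add: binomial_le_pow binomial_eq_0)
  also have "2 * v * (N ^ d * M ^ d) + N ^ d * u0 ^ d = N ^ d * (2 * v * M ^ d + u0 ^ d)"
    by (simp add: algebra_simps)
  finally have "N ^ d * (2 * v * M + u0 + 1) ^ d \<le> N ^ d * (2 * v * M ^ d + u0 ^ d)" by simp
  moreover have "N > 0"
  proof (rule ccontr)
    assume "\<not> N > 0"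
    then have "real (d * (2 * v * M + u0 + 2)) \<le> real 0" using large by simp
    then have "d * (2 * v * M + u0 + 2) \<le> 0" by (simp only: of_nat_le_iff)
    then show False using d by simp
  qed
  ultimately have "(2 * v * M + u0 + 1) ^ d \<le> 2 * v * M ^ d + u0 ^ d" by simp
  moreover have "2 * v * M ^ d \<le> (2 * v * M) ^ d"
    using d v self_le_power[of "2 * v" d] by (simp add: power_mult_distrib mult_right_mono)
  moreover have "(2 * v * M) ^ d + u0 ^ d \<le> (2 * v * M + u0) ^ d" by (rule power_superadditive[OF d])
  moreover have "(2 * v * M + u0) ^ d + 1 ^ d \<le> (2 * v * M + u0 + 1) ^ d" by (rule power_superadditive[OF d])
  ultimately show False by simp
qed

section \<open>Embedding\<close>

text \<open>Induction on \<open>C\<close>: a new vertex \<open>b\<close> costs a factor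
  \<open>2 * k\<close> in candidates, unless \<open>\<beta> b\<close> is one of at most
  \<open>k\<close> exceptional values from \<open>biclique_free_expansion\<close>. The threshold
  grows to \<open>v * (2 * k)\<close>, hence \<open>v\<close> is arbitrary in the induction.\<close>

lemma card_few_nonneighbours_le:
  fixes R :: "('p \<times> 'q) set" and B :: "'b set"
  assumes R: "biclique_free k R" and k: "k \<ge> 1" and fin: "finite B" "finite U" "finite P"
    and D: "D \<subseteq> B"
  shows "finite C \<Longrightarrow> C \<subseteq> B \<Longrightarrow> D \<inter> C = {} \<Longrightarrow> v \<ge> 1 \<Longrightarrow>
    card {\<beta> \<in> B \<rightarrow>\<^sub>E U. v * (2 * k) ^ card C \<le> card {p\<in>P. \<forall>b\<in>D. (p, \<beta> b) \<in> R'} \<and>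
       card {p\<in>P. (\<forall>b\<in>D. (p, \<beta> b) \<in> R') \<and> (\<forall>b\<in>C. (p, \<beta> b) \<notin> R)} < v}
    \<le> card C * (k * card U ^ (card B - 1))"
proof (induction C arbitrary: v rule: finite_induct)
  case empty
  have "{\<beta> \<in> B \<rightarrow>\<^sub>E U. v * (2 * k) ^ card {} \<le> card {p\<in>P. \<forall>b\<in>D. (p, \<beta> b) \<in> R'} \<and>
       card {p\<in>P. (\<forall>b\<in>D. (p, \<beta> b) \<in> R') \<and> (\<forall>b\<in>{}. (p, \<beta> b) \<notin> R)} < v} = {}" by auto
  then show ?case by (metis card.empty le0)
next
  case (insert b C)
  define Z where "Z C \<beta> = {p\<in>P. (\<forall>b\<in>D. (p, \<beta> b) \<in> R') \<and> (\<forall>b\<in>C. (p, \<beta> b) \<notin> R)}" for C \<beta>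
  define S where "S = {\<beta> \<in> B \<rightarrow>\<^sub>E U. v * (2 * k) ^ card (insert b C) \<le> card {p\<in>P. \<forall>b\<in>D. (p, \<beta> b) \<in> R'}
    \<and> card (Z (insert b C) \<beta>) < v}"
  define S1 where "S1 = {\<beta> \<in> B \<rightarrow>\<^sub>E U. (v * (2 * k)) * (2 * k) ^ card C \<le> card {p\<in>P. \<forall>b\<in>D. (p, \<beta> b) \<in> R'}
    \<and> card (Z C \<beta>) < v * (2 * k)}"
  define Pr where "Pr \<beta> \<longleftrightarrow> 2 * k * v \<le> card (Z C \<beta>) \<and> card {p \<in> Z C \<beta>. (p, \<beta> b) \<notin> R} < v" for \<beta>
  have finE: "finite (B \<rightarrow>\<^sub>E U)" using fin by (intro finite_PiE) auto
  have "card S1 \<le> card C * (k * card U ^ (card B - 1))"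
    unfolding S1_def Z_def by (rule insert.IH) (use insert.prems k in auto)
  moreover have "card {\<beta> \<in> B \<rightarrow>\<^sub>E U. Pr \<beta>} \<le> k * card U ^ (card B - 1)"
  proof (rule card_PiE_one_coordinate_le)
    fix \<beta>
    have "Z C (\<beta>(b := y)) = Z C \<beta>" for y
    proof -
      have "(\<beta>(b := y)) b' = \<beta> b'" if "b' \<in> D \<or> b' \<in> C" for b'
        using that insert.hyps insert.prems by auto
      then show ?thesis unfolding Z_def by auto
    qed
    then have eq: "{y\<in>U. Pr (\<beta>(b := y))} =
        (if 2 * k * v \<le> card (Z C \<beta>) then {y\<in>U. card {p \<in> Z C \<beta>. (p, y) \<notin> R} < v} else {})"
      by (auto simp: Pr_def)
    show "card {y\<in>U. Pr (\<beta>(b := y))} \<le> k"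
    proof (cases "2 * k * v \<le> card (Z C \<beta>)")
      case True
      then show ?thesis unfolding eq
        by (simp, intro biclique_free_expansion[OF R k insert.prems(3), of _ "Z C \<beta>"])
           (use fin in \<open>auto simp: Z_def\<close>)
    qed (simp add: eq)
  qed (use fin insert.prems in auto)
  moreover have "S \<subseteq> S1 \<union> {\<beta> \<in> B \<rightarrow>\<^sub>E U. Pr \<beta>}"
  proof
    fix \<beta> assume "\<beta> \<in> S"
    moreover have "Z (insert b C) \<beta> = {p \<in> Z C \<beta>. (p, \<beta> b) \<notin> R}" by (auto simp: Z_def)
    ultimately show "\<beta> \<in> S1 \<union> {\<beta> \<in> B \<rightarrow>\<^sub>E U. Pr \<beta>}"
      using insert.hyps by (auto simp: S_def S1_def Pr_def mult_ac)
  qed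
  then have "card S \<le> card S1 + card {\<beta> \<in> B \<rightarrow>\<^sub>E U. Pr \<beta>}"
    using finE by (intro order.trans[OF card_mono card_Un_le]) (auto simp: S1_def)
  ultimately have "card S \<le> card (insert b C) * (k * card U ^ (card B - 1))"
    using insert.hyps by simp
  then show ?case unfolding S_def Z_def by simp
qed

lemma card_noninjective_le:
  assumes fin: "finite B" "finite U"
  shows "card {\<beta> \<in> B \<rightarrow>\<^sub>E U. \<not> inj_on \<beta> B} \<le> card B * card B * card U ^ (card B - 1)"
proof -
  let ?S = "\<lambda>(b, b'). {\<beta> \<in> B \<rightarrow>\<^sub>E U. b \<noteq> b' \<and> \<beta> b = \<beta> b'}"
  have finE: "finite (B \<rightarrow>\<^sub>E U)" using fin by (intro finite_PiE) auto
  have "card (?S p) \<le> card U ^ (card B - 1)" if "p \<in> B \<times> B" for p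
  proof -
    obtain b b' where p: "p = (b, b')" "b \<in> B" "b' \<in> B" using \<open>p \<in> B \<times> B\<close> by auto
    have "card {\<beta> \<in> B \<rightarrow>\<^sub>E U. b \<noteq> b' \<and> \<beta> b = \<beta> b'} \<le> 1 * card U ^ (card B - 1)"
    proof (rule card_PiE_one_coordinate_le[OF fin p(2)])
      fix \<beta> assume "\<beta> \<in> B \<rightarrow>\<^sub>E U"
      have "{y\<in>U. b \<noteq> b' \<and> (\<beta>(b := y)) b = (\<beta>(b := y)) b'} \<subseteq> {\<beta> b'}" by auto
      from card_mono[OF _ this]
      show "card {y\<in>U. b \<noteq> b' \<and> (\<beta>(b := y)) b = (\<beta>(b := y)) b'} \<le> 1" by simp
    qed
    then show ?thesis by (simp add: p)
  qed
  then have "(\<Sum>p\<in>B \<times> B. card (?S p)) \<le> card (B \<times> B) * card U ^ (card B - 1)"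
    using sum_bounded_above[of "B \<times> B" "\<lambda>p. card (?S p)"] by simp
  moreover have "card (\<Union>p\<in>B \<times> B. ?S p) \<le> (\<Sum>p\<in>B \<times> B. card (?S p))"
    by (rule card_UN_le) (use fin in auto)
  moreover have "card {\<beta> \<in> B \<rightarrow>\<^sub>E U. \<not> inj_on \<beta> B} \<le> card (\<Union>p\<in>B \<times> B. ?S p)"
    by (rule card_mono) (use fin finE in \<open>auto simp: inj_on_def\<close>)
  ultimately show ?thesis by (simp add: card_cartesian_product)
qed

text \<open>Union bound for a random map: \<open>S1\<close> is failure of injectivity,
  \<open>S2\<close> too few common neighbors, \<open>S3\<close> too few candidates left by the
  non-adjacencies. By \<open>bad\<close>, \<open>S2\<close> takes at most half of all maps; the rest
  take less than half since \<open>card U\<close> is large. Each \<open>a\<close> gets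
  \<open>v\<close> candidates to leave room for distinct choices.\<close>

lemma exists_embedding:
  fixes R :: "('p \<times> 'q) set" and B :: "'b set" and A :: "'a set"
  assumes R: "biclique_free k R" and k: "k \<ge> 1" and fin: "finite A" "finite B" "finite U" "finite P"
    and cB: "d \<le> card B" "card B \<le> v" "1 \<le> card B" and cA: "card A \<le> v"
    and D: "\<And>a. a \<in> A \<Longrightarrow> D a \<subseteq> B \<and> card (D a) \<le> d"
    and U: "2 * v\<^sup>2 * (k + 1) + 1 \<le> card U"
    and bad: "2 * v * card {\<gamma>\<in>{..<d} \<rightarrow>\<^sub>E U. card (common_left R' P (\<gamma> ` {..<d})) < v * (2 * k) ^ v}
      \<le> card U ^ d"
  shows "\<exists>\<beta>\<in>B \<rightarrow>\<^sub>E U. inj_on \<beta> B \<and>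
    (\<forall>a\<in>A. v \<le> card {p\<in>P. (\<forall>b\<in>D a. (p, \<beta> b) \<in> R') \<and> (\<forall>b\<in>B - D a. (p, \<beta> b) \<notin> R)})"
proof (rule ccontr)
  assume neg: "\<not> ?thesis"
  define m where "m = card B"
  define u where "u = card U"
  define M where "M = v * (2 * k) ^ v"
  define E where "E = B \<rightarrow>\<^sub>E U"
  define W where "W a \<beta> = {p\<in>P. \<forall>b\<in>D a. (p, \<beta> b) \<in> R'}" for a \<beta>
  define Z where "Z a \<beta> = {p\<in>P. (\<forall>b\<in>D a. (p, \<beta> b) \<in> R') \<and> (\<forall>b\<in>B - D a. (p, \<beta> b) \<notin> R)}" for a \<beta>
  define S1 where "S1 = {\<beta> \<in> B \<rightarrow>\<^sub>E U. \<not> inj_on \<beta> B}"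
  define S2 where "S2 a = {\<beta> \<in> B \<rightarrow>\<^sub>E U. card (W a \<beta>) < M}" for a
  define S3 where "S3 a = {\<beta> \<in> B \<rightarrow>\<^sub>E U. M \<le> card (W a \<beta>) \<and> card (Z a \<beta>) < v}" for a
  have v: "v \<ge> 1" using cB by simp
  have finE: "finite E" unfolding E_def using fin by (intro finite_PiE) auto
  have "E \<subseteq> S1 \<union> (\<Union>a\<in>A. S2 a) \<union> (\<Union>a\<in>A. S3 a)"
  proof
    fix \<beta> assume b: "\<beta> \<in> E"
    then have "\<not> inj_on \<beta> B \<or> (\<exists>a\<in>A. card (Z a \<beta>) < v)" using neg by (force simp: E_def Z_def not_le)
    moreover have "\<beta> \<in> S2 a \<union> S3 a" if "card (Z a \<beta>) < v" for a
      using that b by (cases "card (W a \<beta>) < M") (auto simp: S2_def S3_def E_def)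
    moreover have "\<beta> \<in> S1" if "\<not> inj_on \<beta> B" using that b by (simp add: S1_def E_def)
    ultimately show "\<beta> \<in> S1 \<union> (\<Union>a\<in>A. S2 a) \<union> (\<Union>a\<in>A. S3 a)" by blast
  qed
  moreover have sub: "S1 \<subseteq> E" "S2 a \<subseteq> E" "S3 a \<subseteq> E" for a
    by (auto simp: S1_def S2_def S3_def E_def)
  moreover have "S1 \<union> (\<Union>a\<in>A. S2 a) \<union> (\<Union>a\<in>A. S3 a) \<subseteq> E" using sub by blast
  ultimately have "card E \<le> card (S1 \<union> (\<Union>a\<in>A. S2 a) \<union> (\<Union>a\<in>A. S3 a))"
    by (intro card_mono finite_subset[OF _ finE])
  also have "\<dots> \<le> card S1 + card (\<Union>a\<in>A. S2 a) + card (\<Union>a\<in>A. S3 a)"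
    by (meson add_le_mono card_Un_le order.trans order_refl)
  also have "\<dots> \<le> card S1 + (\<Sum>a\<in>A. card (S2 a)) + (\<Sum>a\<in>A. card (S3 a))"
    by (intro add_mono card_UN_le fin) auto
  finally have total: "u ^ m \<le> card S1 + (\<Sum>a\<in>A. card (S2 a)) + (\<Sum>a\<in>A. card (S3 a))"
    using fin by (simp add: E_def card_PiE u_def m_def)
  have s1: "card S1 \<le> m * m * u ^ (m - 1)"
    unfolding S1_def m_def u_def by (rule card_noninjective_le[OF fin(2,3)])
  have s2: "2 * v * card (S2 a) \<le> u ^ m" if a: "a \<in> A" for a
  proof -
    \<comment> \<open>\<open>bad\<close> speaks of \<open>d\<close>-tuples, so a smaller
      \<open>D a\<close> is enlarged; this only shrinks the common neighborhood.\<close>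
    obtain D' where D': "D a \<subseteq> D'" "D' \<subseteq> B" "card D' = d"
      using exists_subset_between[of "D a" d B] D[OF a] cB fin by auto
    have "finite D'" using D'(2) fin(2) by (rule finite_subset)
    then obtain g where g: "bij_betw g {..<d} D'"
      using D'(3) ex_bij_betw_nat_finite[of D'] by (auto simp: atLeast0LessThan)
    have "S2 a \<subseteq> {\<beta> \<in> B \<rightarrow>\<^sub>E U. card (common_left R' P (restrict (\<beta> \<circ> g) {..<d} ` {..<d})) < M}"
    proof
      fix \<beta> assume b: "\<beta> \<in> S2 a"
      have "restrict (\<beta> \<circ> g) {..<d} ` {..<d} = \<beta> ` D'"
        using g by (auto simp: bij_betw_def image_comp)
      then have "common_left R' P (restrict (\<beta> \<circ> g) {..<d} ` {..<d}) \<subseteq> W a \<beta>"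
        using D' by (auto simp: common_left_def W_def)
      then have "card (common_left R' P (restrict (\<beta> \<circ> g) {..<d} ` {..<d})) \<le> card (W a \<beta>)"
        using fin by (intro card_mono) (auto simp: W_def)
      then show "\<beta> \<in> {\<beta> \<in> B \<rightarrow>\<^sub>E U. card (common_left R' P (restrict (\<beta> \<circ> g) {..<d} ` {..<d})) < M}"
        using b by (auto simp: S2_def)
    qed
    then have "card (S2 a) \<le> card {\<beta> \<in> B \<rightarrow>\<^sub>E U. card (common_left R' P (restrict (\<beta> \<circ> g) {..<d} ` {..<d})) < M}"
      using finE by (intro card_mono) (auto simp: E_def)
    also have "\<dots> \<le> card {\<gamma>\<in>{..<d} \<rightarrow>\<^sub>E U. card (common_left R' P (\<gamma> ` {..<d})) < M} * u ^ (m - card {..<d})"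
      unfolding u_def m_def
      by (rule card_PiE_restrict_le) (use fin g D' in \<open>auto simp: bij_betw_def\<close>)
    finally have "2 * v * card (S2 a) \<le>
        (2 * v * card {\<gamma>\<in>{..<d} \<rightarrow>\<^sub>E U. card (common_left R' P (\<gamma> ` {..<d})) < M}) * u ^ (m - d)"
      by simp
    also have "\<dots> \<le> u ^ d * u ^ (m - d)"
      using bad by (intro mult_right_mono) (simp_all add: u_def M_def)
    also have "\<dots> = u ^ m" using cB by (simp add: power_add[symmetric] m_def)
    finally show ?thesis .
  qed
  have s3: "card (S3 a) \<le> v * (k * u ^ (m - 1))" if a: "a \<in> A" for a
  proof -
    have cC: "card (B - D a) \<le> v" using card_mono[of B "B - D a"] fin cB by auto
    have "v * (2 * k) ^ card (B - D a) \<le> M"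
      unfolding M_def using cC k by (intro mult_le_mono2 power_increasing) auto
    then have "S3 a \<subseteq> {\<beta> \<in> B \<rightarrow>\<^sub>E U. v * (2 * k) ^ card (B - D a) \<le> card {p\<in>P. \<forall>b\<in>D a. (p, \<beta> b) \<in> R'} \<and>
       card {p\<in>P. (\<forall>b\<in>D a. (p, \<beta> b) \<in> R') \<and> (\<forall>b\<in>B - D a. (p, \<beta> b) \<notin> R)} < v}"
      unfolding S3_def W_def Z_def by auto
    then have "card (S3 a) \<le> card {\<beta> \<in> B \<rightarrow>\<^sub>E U. v * (2 * k) ^ card (B - D a) \<le> card {p\<in>P. \<forall>b\<in>D a. (p, \<beta> b) \<in> R'} \<and>
       card {p\<in>P. (\<forall>b\<in>D a. (p, \<beta> b) \<in> R') \<and> (\<forall>b\<in>B - D a. (p, \<beta> b) \<notin> R)} < v}"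
      using finE by (intro card_mono) (auto simp: E_def)
    also have "\<dots> \<le> card (B - D a) * (k * u ^ (m - 1))"
      unfolding u_def m_def
      by (rule card_few_nonneighbours_le[OF R k fin(2,3,4)]) (use D[OF a] fin v in auto)
    also have "\<dots> \<le> v * (k * u ^ (m - 1))" using cC by (rule mult_right_mono) simp
    finally show ?thesis .
  qed
  have "v * (2 * (\<Sum>a\<in>A. card (S2 a))) = (\<Sum>a\<in>A. 2 * v * card (S2 a))"
    by (simp add: sum_distrib_left mult_ac)
  also have "\<dots> \<le> card A * u ^ m" using sum_bounded_above[of A, OF s2] by simp
  also have "\<dots> \<le> v * u ^ m" using cA by (rule mult_right_mono) simp
  finally have S2: "2 * (\<Sum>a\<in>A. card (S2 a)) \<le> u ^ m" using v by simp
  have "(\<Sum>a\<in>A. card (S3 a)) \<le> card A * (v * (k * u ^ (m - 1)))"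
    using sum_bounded_above[of A, OF s3] by simp
  also have "\<dots> \<le> v * (v * (k * u ^ (m - 1)))" using cA by (rule mult_right_mono) simp
  finally have S3: "(\<Sum>a\<in>A. card (S3 a)) \<le> v\<^sup>2 * k * u ^ (m - 1)"
    by (simp add: power2_eq_square mult_ac)
  have "m * m \<le> v\<^sup>2" using cB by (simp add: m_def power2_eq_square mult_le_mono)
  then have S1: "card S1 \<le> v\<^sup>2 * u ^ (m - 1)"
    using s1 by (meson mult_le_mono1 order.trans)
  have um: "u ^ m = u * u ^ (m - 1)" using cB by (cases m) (auto simp: m_def)
  have arith: "x \<le> a + b + c \<Longrightarrow> 2 * b \<le> x \<Longrightarrow> a \<le> a' \<Longrightarrow> c \<le> c' \<Longrightarrow> x \<le> 2 * (a' + c')"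
    for x a b c a' c' :: nat by simp
  have "u * u ^ (m - 1) \<le> 2 * (v\<^sup>2 * u ^ (m - 1) + v\<^sup>2 * k * u ^ (m - 1))"
    using arith[OF total S2 S1 S3] unfolding um .
  also have "\<dots> = (2 * v\<^sup>2 * (k + 1)) * u ^ (m - 1)" by (simp add: algebra_simps)
  finally have "u \<le> 2 * v\<^sup>2 * (k + 1)" using U by (simp add: u_def)
  then show False using U by (simp add: u_def)
qed

text \<open>Greedy choice: fewer than \<open>card A\<close> values are already taken, too few to
  exhaust the next set.\<close>

lemma exists_distinct_representatives:
  assumes "finite A" "\<And>a. a \<in> A \<Longrightarrow> card A \<le> card (Z a)"
  shows "\<exists>g. inj_on g A \<and> (\<forall>a\<in>A. g a \<in> Z a)"
  using assms
proof (induction A rule: finite_induct)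
  case (insert a A)
  then obtain g where g: "inj_on g A" "\<forall>a\<in>A. g a \<in> Z a"
    by (metis card_insert_le insertCI order.trans)
  have "card (g ` A) < card (Z a)"
    using insert card_image_le[of A g] by (metis card_insert_disjoint insertI1 le_imp_less_Suc order_less_le_trans)
  then have "\<not> Z a \<subseteq> g ` A"
    using insert.hyps card_mono[of "g ` A" "Z a"] by auto
  then obtain z where z: "z \<in> Z a" "z \<notin> g ` A" by blast
  have "inj_on (g(a := z)) (insert a A)"
    using g(1) z insert.hyps by (auto simp: inj_on_def)
  moreover have "\<forall>a'\<in>insert a A. (g(a := z)) a' \<in> Z a'" using g(2) z by auto
  ultimately show ?case by blast
qed auto

text \<open>The bound \<open>d \<le> card B\<close> holds because the biclique is connected, so one
  of its sides lies in \<open>B\<close>; with \<open>s \<ge> d\<close>, either side has at least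
  \<open>d\<close> vertices.\<close>

lemma d_bounded_parts:
  assumes H: "d_bounded d V E" and K: "contains_Kst d s V E" and d: "d \<ge> 1" and s: "s \<ge> d"
  obtains A B F where "finite V" "A \<inter> B = {}" "A \<union> B = V" "d \<le> card B"
    "\<And>e. e \<in> E \<Longrightarrow> \<exists>a\<in>A. \<exists>b\<in>B. e = {a, b}"
    "F = {a\<in>A. \<forall>b\<in>B. {a, b} \<in> E}" "card F \<le> d"
    "\<And>a. a \<in> A - F \<Longrightarrow> card {b\<in>B. {a, b} \<in> E} \<le> d"
proof -
  from H obtain A B where fin: "finite V" and AB: "A \<inter> B = {}" "A \<union> B = V"
    and E: "\<forall>e\<in>E. \<exists>a\<in>A. \<exists>b\<in>B. e = {a, b}"
    and F: "card {a\<in>A. \<forall>b\<in>B. {a, b} \<in> E} \<le> d"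
      "\<forall>a\<in>A - {a\<in>A. \<forall>b\<in>B. {a, b} \<in> E}. card {v\<in>V. {a, v} \<in> E} \<le> d"
    by (auto simp: d_bounded_def graph_def Let_def)
  have D: "card {b\<in>B. {a, b} \<in> E} \<le> d" if "a \<in> A - {a\<in>A. \<forall>b\<in>B. {a, b} \<in> E}" for a
  proof -
    have "card {b\<in>B. {a, b} \<in> E} \<le> card {v\<in>V. {a, v} \<in> E}"
      using fin AB by (intro card_mono) auto
    also have "\<dots> \<le> d" by (rule bspec[OF F(2) that])
    finally show ?thesis .
  qed
  from K obtain Y Z where YZ: "Y \<subseteq> V" "Z \<subseteq> V" "card Y = d" "card Z = s"
    and YZE: "\<And>y z. y \<in> Y \<Longrightarrow> z \<in> Z \<Longrightarrow> {y, z} \<in> E"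
    by (auto simp: contains_Kst_def)
  obtain y0 where y0: "y0 \<in> Y" using YZ d by (metis all_not_in_conv card.empty not_one_le_zero)
  have sides: "(u \<in> A \<longrightarrow> w \<in> B) \<and> (u \<in> B \<longrightarrow> w \<in> A)" if uw: "{u, w} \<in> E" for u w
  proof -
    obtain a b where ab: "a \<in> A" "b \<in> B" "{u, w} = {a, b}" using bspec[OF E uw] by blast
    then have "u = a \<and> w = b \<or> u = b \<and> w = a" by (auto simp: doubleton_eq_iff)
    moreover have "a \<notin> B" "b \<notin> A" using ab AB(1) by auto
    ultimately show ?thesis using ab by auto
  qed
  have finB: "finite B" using fin AB by (metis finite_Un)
  have "d \<le> card B"
  proof (cases "y0 \<in> A")
    case True
    then have "Z \<subseteq> B" using sides YZE[OF y0] by blast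
    from card_mono[OF finB this] show ?thesis using YZ(4) s by simp
  next
    case False
    then have y0B: "y0 \<in> B" using y0 YZ AB by blast
    obtain z0 where z0: "z0 \<in> Z" using YZ d s by (metis all_not_in_conv card.empty le_trans not_one_le_zero)
    then have "z0 \<in> A" using sides YZE[OF y0 z0] y0B by blast
    have "Y \<subseteq> B"
    proof
      fix y assume "y \<in> Y"
      then have "{z0, y} \<in> E" using YZE[OF _ z0] by (simp add: insert_commute)
      then show "y \<in> B" using sides \<open>z0 \<in> A\<close> by blast
    qed
    from card_mono[OF finB this] show ?thesis using YZ(3) by simp
  qed
  show ?thesis
    by (rule that[OF fin AB \<open>d \<le> card B\<close> _ refl F(1) D]) (use E in auto)
qed

lemma majority_color:
  assumes fin: "finite R" and c: "\<And>p q. (p, q) \<in> R \<Longrightarrow> c p q < (r :: nat)" and r: "r \<ge> 1"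
  shows "\<exists>i<r. card R \<le> r * card {(p, q) \<in> R. c p q = i}"
proof (rule ccontr)
  assume neg: "\<not> ?thesis"
  have "R = (\<Union>i<r. {(p, q) \<in> R. c p q = i})" using c by auto
  then have "card R \<le> (\<Sum>i<r. card {(p, q) \<in> R. c p q = i})"
    using card_UN_le[of "{..<r}" "\<lambda>i. {(p, q) \<in> R. c p q = i}"] by simp
  then have "r * card R \<le> (\<Sum>i<r. r * card {(p, q) \<in> R. c p q = i})"
    by (simp add: sum_distrib_left[symmetric])
  also have "\<dots> < (\<Sum>i<r. card R)"
    by (rule sum_strict_mono) (use neg r in \<open>auto simp: not_le lessThan_empty_iff\<close>)
  finally show False by simp
qed

text \<open>\<open>large\<close> is the size condition of \<open>dependent_random_choice\<close> for
  density 1/(2r), with \<open>M\<close> and \<open>u0\<close> set to the amounts that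
  \<open>exists_embedding\<close> consumes.\<close>

lemma exists_ind_ramsey_graph:
  fixes V :: "'a set"
  assumes H: "d_bounded d V E" and K: "contains_Kst d s V E" and d: "d \<ge> 1" and s: "s \<ge> d"
    and r: "r \<ge> 1" and v: "v = card V" and k: "k = 2 * l + 2"
    and large: "real (d * (2 * v * (v * (2 * k) ^ v) + (2 * v\<^sup>2 * (k + 1) + 1) + 2)) \<le> 2 ^ l * (1 / (2 * r)) ^ d"
  shows "\<exists>EG. graph {0..<2 * 2 ^ l} EG \<and> ind_ramsey_graph V E r {0..<2 * 2 ^ l :: nat} EG"
proof -
  obtain A B F where finV: "finite V" and AB: "A \<inter> B = {}" "A \<union> B = V" and cB: "d \<le> card B"
    and E: "\<And>e. e \<in> E \<Longrightarrow> \<exists>a\<in>A. \<exists>b\<in>B. e = {a, b}"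
    and F: "F = {a\<in>A. \<forall>b\<in>B. {a, b} \<in> E}" and cF: "card F \<le> d"
    and D: "\<And>a. a \<in> A - F \<Longrightarrow> card {b\<in>B. {a, b} \<in> E} \<le> d"
    by (rule d_bounded_parts[OF H K d s]) (rule that; assumption)
  have finAB: "finite A" "finite B" using finV AB by auto
  have finF: "finite F" using finAB by (simp add: F)
  have cv: "card (A - F) \<le> v" "card B \<le> v"
    using finV AB by (auto simp: v intro!: card_mono)
  define N where "N = (2 :: nat) ^ l"
  define P where "P = {0..<N}"
  define Q where "Q = {N..<2 * N}"
  have finPQ: "finite P" "finite Q" and cPQ: "card P = N" "card Q = N" by (auto simp: P_def Q_def)
  obtain R where R: "R \<subseteq> P \<times> Q" "card (P \<times> Q) \<le> 2 * card R" "biclique_free k R"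
    using exists_dense_biclique_free[OF finPQ, of l] cPQ k by (auto simp: N_def)
  have finR: "finite R" using R(1) finPQ by (meson finite_SigmaI finite_subset)
  define EG where "EG = (\<lambda>(p, q). {p, q}) ` R"
  have EG_iff: "{p, q} \<in> EG \<longleftrightarrow> (p, q) \<in> R" if "p \<in> P" "q \<in> Q" for p q
  proof
    assume "{p, q} \<in> EG"
    then obtain p' q' where pq': "(p', q') \<in> R" "{p, q} = {p', q'}" by (auto simp: EG_def)
    then have "p' \<in> P" "q' \<in> Q" using R(1) by auto
    then have "p = p' \<and> q = q'" using pq'(2) that by (auto simp: doubleton_eq_iff P_def Q_def)
    then show "(p, q) \<in> R" using pq'(1) by simp
  qed (auto simp: EG_def)
  have EG_sides: "\<not> (p \<in> P \<and> q \<in> P)" "\<not> (p \<in> Q \<and> q \<in> Q)" if pq: "{p, q} \<in> EG" for p q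
  proof -
    obtain p' q' where pq': "(p', q') \<in> R" "{p, q} = {p', q'}" using pq by (auto simp: EG_def)
    then have "p' \<in> P" "q' \<in> Q" using R(1) by auto
    then show "\<not> (p \<in> P \<and> q \<in> P)" "\<not> (p \<in> Q \<and> q \<in> Q)"
      using pq'(2) by (auto simp: doubleton_eq_iff P_def Q_def)
  qed
  have PQ: "P \<union> Q = {0..<2 * N}" "P \<inter> Q = {}" by (auto simp: P_def Q_def)
  have graph: "graph {0..<2 * N} EG"
  proof -
    have "\<exists>u w. {p, q} = {u, w} \<and> u \<in> {0..<2 * N} \<and> w \<in> {0..<2 * N} \<and> u \<noteq> w" if "(p, q) \<in> R" for p q
      using that R(1) by (intro exI[of _ p] exI[of _ q]) (auto simp: P_def Q_def)
    then show ?thesis unfolding graph_def EG_def by fastforce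
  qed
  moreover have "ind_ramsey_graph V E r {0..<2 * N} EG"
    unfolding ind_ramsey_graph_def
  proof (intro allI impI)
    fix c :: "nat set \<Rightarrow> nat" assume c: "\<forall>e\<in>EG. c e < r"
    have "c {p, q} < r" if "(p, q) \<in> R" for p q using c that by (auto simp: EG_def)
    from majority_color[of R "\<lambda>p q. c {p, q}", OF finR this r] obtain i
      where i: "card R \<le> r * card {(p, q) \<in> R. c {p, q} = i}" by blast
    define R' where "R' = {(p, q) \<in> R. c {p, q} = i}"
    have R'R: "R' \<subseteq> R" and R'c: "\<And>p q. (p, q) \<in> R' \<Longrightarrow> c {p, q} = i" by (auto simp: R'_def)
    have "N * N \<le> 2 * (r * card R')"
      using R(2) i by (simp add: card_cartesian_product cPQ R'_def)
    then have "real (N * N) \<le> real (2 * (r * card R'))" by (simp only: of_nat_le_iff)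
    then have dens: "1 / (2 * r) * real (card P) * real (card Q) \<le> card R'"
      using r by (simp add: cPQ field_simps)
    have "v \<ge> 1" using cv cB d by simp
    have "\<exists>T\<subseteq>P. card T = d \<and> 2 * v\<^sup>2 * (k + 1) + 1 \<le> card (common_right R' Q T) \<and>
        2 * v * card {\<gamma>\<in>{..<d} \<rightarrow>\<^sub>E common_right R' Q T.
            card (common_left R' P (\<gamma> ` {..<d})) < v * (2 * k) ^ v}
          \<le> card (common_right R' Q T) ^ d"
    proof (rule dependent_random_choice[OF finPQ cPQ _ d _ \<open>v \<ge> 1\<close> dens])
      show "real (d * (2 * v * (v * (2 * k) ^ v) + (2 * v\<^sup>2 * (k + 1) + 1) + 2)) \<le> N * (1 / (2 * r)) ^ d"
        using large by (simp add: N_def)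
    qed (use R(1) R'R in auto)
    then obtain T where T: "T \<subseteq> P" "card T = d"
      and U: "2 * v\<^sup>2 * (k + 1) + 1 \<le> card (common_right R' Q T)"
      and bad: "2 * v * card {\<gamma>\<in>{..<d} \<rightarrow>\<^sub>E common_right R' Q T.
            card (common_left R' P (\<gamma> ` {..<d})) < v * (2 * k) ^ v}
          \<le> card (common_right R' Q T) ^ d" by blast
    define U where "U = common_right R' Q T"
    define nb where "nb a = {b\<in>B. {a, b} \<in> E}" for a
    have finU: "finite U" using finPQ by (auto simp: U_def common_right_def)
    \<comment> \<open>Edges are asked for in \<open>R'\<close>, non-edges in \<open>R\<close>: an
      edge of any color would spoil an induced copy.\<close>
    have "\<exists>\<beta>\<in>B \<rightarrow>\<^sub>E U. inj_on \<beta> B \<and> (\<forall>a\<in>A - F. v \<le> card {p\<in>P. (\<forall>b\<in>nb a. (p, \<beta> b) \<in> R') \<and>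
        (\<forall>b\<in>B - nb a. (p, \<beta> b) \<notin> R)})"
      by (rule exists_embedding[OF R(3) _ _ finAB(2) finU finPQ(1) cB cv(2) _ cv(1) _ U[folded U_def] bad[folded U_def]])
         (use k finAB cB d D in \<open>auto simp: nb_def\<close>)
    then obtain \<beta> where \<beta>: "\<beta> \<in> B \<rightarrow>\<^sub>E U" "inj_on \<beta> B"
      and Z: "\<And>a. a \<in> A - F \<Longrightarrow> v \<le> card {p\<in>P. (\<forall>b\<in>nb a. (p, \<beta> b) \<in> R') \<and>
        (\<forall>b\<in>B - nb a. (p, \<beta> b) \<notin> R)}" by blast
    define Z where "Z a = {p\<in>P. (\<forall>b\<in>nb a. (p, \<beta> b) \<in> R') \<and> (\<forall>b\<in>B - nb a. (p, \<beta> b) \<notin> R)}" for a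
    have "\<exists>g. inj_on g (A - F) \<and> (\<forall>a\<in>A - F. g a \<in> Z a)"
      by (rule exists_distinct_representatives)
         (use finAB Z cv in \<open>auto simp: Z_def intro: order.trans\<close>)
    then obtain g where g: "inj_on g (A - F)" "\<And>a. a \<in> A - F \<Longrightarrow> g a \<in> Z a" by blast
    have "finite T" using T finPQ finite_subset by blast
    then obtain f where f: "f ` F \<subseteq> T" "inj_on f F"
      using card_le_inj[of F T] finF cF T by auto
    define \<phi> where "\<phi> x = (if x \<in> B then \<beta> x else if x \<in> F then f x else g x)" for x
    have \<phi>B: "\<phi> b = \<beta> b" if "b \<in> B" for b using that by (simp add: \<phi>_def)
    have \<phi>F: "\<phi> a = f a" if "a \<in> F" for a using that AB by (auto simp: \<phi>_def F)
    have \<phi>A: "\<phi> a = g a" if "a \<in> A - F" for a using that AB by (auto simp: \<phi>_def)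
    have \<beta>U: "\<beta> b \<in> U" if "b \<in> B" for b using \<beta>(1) that by (auto simp: PiE_iff)
    have U_Q: "u \<in> Q" "\<And>t. t \<in> T \<Longrightarrow> (t, u) \<in> R'" if "u \<in> U" for u
      using that by (auto simp: U_def common_right_def)
    have \<phi>Q: "\<phi> b \<in> Q" if "b \<in> B" for b using U_Q(1)[OF \<beta>U[OF that]] \<phi>B[OF that] by simp
    have \<phi>P: "\<phi> a \<in> P" if "a \<in> A" for a
    proof (cases "a \<in> F")
      case True
      then show ?thesis using f T \<phi>F by auto
    next
      case False
      then show ?thesis using that g(2)[of a] \<phi>A[of a] by (auto simp: Z_def)
    qed
    have edge: "(\<phi> a, \<phi> b) \<in> R'" if "a \<in> A" "b \<in> B" "{a, b} \<in> E" for a b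
    proof (cases "a \<in> F")
      case True
      then have "f a \<in> T" using f by auto
      then show ?thesis using U_Q(2)[OF \<beta>U[OF that(2)]] \<phi>F[OF True] \<phi>B[OF that(2)] by simp
    next
      case False
      then show ?thesis using that g(2)[of a] \<phi>A[of a] \<phi>B by (auto simp: Z_def nb_def)
    qed
    have nonedge: "(\<phi> a, \<phi> b) \<notin> R" if "a \<in> A" "b \<in> B" "{a, b} \<notin> E" for a b
    proof -
      have "a \<in> A - F" using that by (auto simp: F)
      then show ?thesis using that g(2)[of a] \<phi>A[of a] \<phi>B[of b] by (auto simp: Z_def nb_def)
    qed
    have inj: "inj_on \<phi> V"
    proof (rule inj_onI)
      fix x y assume xy: "x \<in> V" "y \<in> V" "\<phi> x = \<phi> y"
      \<comment> \<open>\<open>f\<close> and \<open>g\<close> are chosen independently, so their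
        images might meet in \<open>P\<close>. They do not: a vertex outside \<open>F\<close> misses
        some \<open>b\<close>, and this non-adjacency tells the images apart.\<close>
      have cross: False if "a \<in> F" "a' \<in> A - F" "\<phi> a = \<phi> a'" for a a'
      proof -
        obtain b where b: "b \<in> B" "{a', b} \<notin> E" using \<open>a' \<in> A - F\<close> by (auto simp: F)
        have "a \<in> A" "{a, b} \<in> E" using that(1) b by (auto simp: F)
        then have "(\<phi> a, \<phi> b) \<in> R" using edge b R'R by blast
        moreover have "(\<phi> a', \<phi> b) \<notin> R" using nonedge b that(2) by blast
        ultimately show False using that(3) by simp
      qed
      consider "x \<in> B" "y \<in> B" | "x \<in> F" "y \<in> F" | "x \<in> A - F" "y \<in> A - F"
        | "x \<in> F" "y \<in> A - F" | "y \<in> F" "x \<in> A - F" | "x \<in> A" "y \<in> B" | "y \<in> A" "x \<in> B"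
        using xy AB by blast
      then show "x = y"
      proof cases
        case 1
        then show ?thesis using xy(3) \<beta>(2) \<phi>B by (auto dest: inj_onD)
      next
        case 2
        then show ?thesis using xy(3) f(2) \<phi>F by (auto dest: inj_onD)
      next
        case 3
        then have "g x = g y" using xy(3) \<phi>A by simp
        then show ?thesis using 3 by (rule inj_onD[OF g(1)])
      next
        case 4
        then show ?thesis using cross xy(3) by blast
      next
        case 5
        then show ?thesis using cross[of y x] xy(3) by simp
      next
        case 6
        then have "\<phi> x \<in> P \<inter> Q" using \<phi>P[of x] \<phi>Q[of y] xy(3) by simp
        then show ?thesis using PQ by simp
      next
        case 7
        then have "\<phi> x \<in> P \<inter> Q" using \<phi>P[of y] \<phi>Q[of x] xy(3) by simp
        then show ?thesis using PQ by simp
      qed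
    qed
    have AB_iff: "{a, b} \<in> E \<longleftrightarrow> {\<phi> a, \<phi> b} \<in> EG" if "a \<in> A" "b \<in> B" for a b
      using edge[OF that] nonedge[OF that] EG_iff[OF \<phi>P[OF that(1)] \<phi>Q[OF that(2)]] R'R by blast
    have E_sides: "\<not> (x \<in> A \<and> y \<in> A)" "\<not> (x \<in> B \<and> y \<in> B)" if "{x, y} \<in> E" for x y
      using E[OF that] AB by (auto simp: doubleton_eq_iff)
    have "{x, y} \<in> E \<longleftrightarrow> {\<phi> x, \<phi> y} \<in> EG" if xy: "x \<in> V" "y \<in> V" for x y
    proof -
      consider "x \<in> A" "y \<in> B" | "x \<in> B" "y \<in> A" | "x \<in> A" "y \<in> A" | "x \<in> B" "y \<in> B"
        using xy AB by blast
      then show ?thesis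
      proof cases
        case 1
        then show ?thesis by (rule AB_iff)
      next
        case 2
        then show ?thesis using AB_iff[of y x] by (simp add: insert_commute)
      next
        case 3
        then show ?thesis using E_sides(1)[of x y] EG_sides(1)[of "\<phi> x" "\<phi> y"] \<phi>P by blast
      next
        case 4
        then show ?thesis using E_sides(2)[of x y] EG_sides(2)[of "\<phi> x" "\<phi> y"] \<phi>Q by blast
      qed
    qed
    moreover have "c (\<phi> ` e) = i" if e: "e \<in> E" for e
    proof -
      obtain a b where ab: "a \<in> A" "b \<in> B" "e = {a, b}" using E[OF e] by blast
      then have "(\<phi> a, \<phi> b) \<in> R'" using edge e by blast
      then show ?thesis using R'c ab by simp
    qed
    moreover have "\<phi> ` V \<subseteq> {0..<2 * N}" using \<phi>P \<phi>Q AB PQ(1) by blast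
    ultimately show "mono_induced_copy V E {0..<2 * N} EG c"
      unfolding mono_induced_copy_def using inj by (intro exI[of _ \<phi>]) blast
  qed
  ultimately show ?thesis unfolding N_def by blast
qed

section \<open>Asymptotics of the induced Ramsey number\<close>

lemma not_ind_ramsey_small:
  fixes V :: "'a set" and EG :: "nat set set"
  assumes d: "d \<ge> 1" and k: "k \<ge> 1" "2 ^ k \<le> r" and N: "N \<le> 2 ^ (k * d)"
    and K: "contains_Kst d s V E" and s: "s > (d * (d + 3)) ^ d" and G: "graph {0..<N} EG"
  shows "\<not> ind_ramsey_graph V E r {0..<N} EG"
proof
  assume ramsey: "ind_ramsey_graph V E r {0..<N} EG"
  obtain \<chi> :: "nat \<Rightarrow> nat \<Rightarrow> nat" where sym: "\<forall>u v. \<chi> u v = \<chi> v u"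
    and range: "\<forall>u < 2 ^ (k * d). \<forall>v < 2 ^ (k * d). \<chi> u v < 2 ^ k"
    and free: "\<forall>U W c. U \<subseteq> {..<2 ^ (k * d)} \<longrightarrow> W \<subseteq> {..<2 ^ (k * d)} \<longrightarrow> card U = d \<longrightarrow>
       (\<forall>u\<in>U. \<forall>w\<in>W. \<chi> u w = c) \<longrightarrow> card W \<le> (d * (d + 3)) ^ d"
    using norm_graph_coloring[OF d k(1)] by (elim exE conjE)
  \<comment> \<open>Edges are unordered; ordering the ends by \<open>Min\<close> and
    \<open>Max\<close> is harmless because \<open>\<chi>\<close> is symmetric.\<close>
  define c where "c e = \<chi> (Min e) (Max e)" for e :: "nat set"
  have c: "c {u, w} = \<chi> u w" for u w
    using sym by (cases "u \<le> w") (simp_all add: c_def min_def max_def)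
  have "c e < r" if e: "e \<in> EG" for e
  proof -
    have "e \<in> {{u, v} | u v. u \<in> {0..<N} \<and> v \<in> {0..<N} \<and> u \<noteq> v}"
      using G e by (auto simp only: graph_def)
    then obtain u w where uw: "e = {u, w}" "u < N" "w < N" by auto
    then have "\<chi> u w < 2 ^ k" using range N by simp
    then show ?thesis using uw(1) c k(2) by simp
  qed
  then have "mono_induced_copy V E {0..<N} EG c" using ramsey by (simp add: ind_ramsey_graph_def)
  then obtain \<phi> col where \<phi>: "\<phi> ` V \<subseteq> {0..<N}" "inj_on \<phi> V" "\<forall>e\<in>E. c (\<phi> ` e) = col"
    unfolding mono_induced_copy_def by (elim exE conjE)
  from K obtain Y Z where YZ: "Y \<subseteq> V" "Z \<subseteq> V" "card Y = d" "card Z = s"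
    and YZE: "\<forall>y\<in>Y. \<forall>z\<in>Z. {y, z} \<in> E"
    unfolding contains_Kst_def by (elim exE conjE)
  have sub: "\<phi> ` S \<subseteq> {..<2 ^ (k * d)}" if "S \<subseteq> V" for S
  proof -
    have "\<phi> ` S \<subseteq> {0..<N}" using that \<phi>(1) by auto
    also have "\<dots> \<subseteq> {..<2 ^ (k * d)}" using N by auto
    finally show ?thesis .
  qed
  have "\<chi> (\<phi> y) (\<phi> z) = col" if "y \<in> Y" "z \<in> Z" for y z
    using \<phi>(3) YZE that c[of "\<phi> y" "\<phi> z"] by force
  then have "\<forall>u\<in>\<phi> ` Y. \<forall>w\<in>\<phi> ` Z. \<chi> u w = col" by blast
  moreover have "card (\<phi> ` Y) = d" "card (\<phi> ` Z) = s"
    using YZ inj_on_subset[OF \<phi>(2)] by (auto simp: card_image)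
  ultimately have "s \<le> (d * (d + 3)) ^ d"
    using free[rule_format, OF sub[OF YZ(1)] sub[OF YZ(2)]] by blast
  then show False using s by simp
qed

text \<open>A \<open>LEAST\<close> is meaningful only if some Ramsey graph exists; the upper bound
  supplies one through \<open>ex\<close>. The factor (1/2)^d comes from rounding \<open>r\<close>
  down to a power of two.\<close>

lemma r_ind_lower:
  fixes V :: "'a set" and EG :: "nat set set"
  assumes d: "d \<ge> 1" and r: "r \<ge> 2"
    and K: "contains_Kst d s V E" and s: "s > (d * (d + 3)) ^ d"
    and ex: "graph {0..<N} EG" "ind_ramsey_graph V E r {0..<N} EG"
  shows "(1 / 2) ^ d * real r ^ d \<le> real (r_ind V E r)"
proof -
  obtain k where k: "2 ^ k \<le> r" "r < 2 ^ (k + 1)"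
    using ex_power_ivl1[of 2 r] r by auto
  have k1: "k \<ge> 1" using k r by (cases k) auto
  let ?P = "\<lambda>N. \<exists>EG :: nat set set. graph {0..<N} EG \<and> ind_ramsey_graph V E r {0..<N} EG"
  have "?P (r_ind V E r)" unfolding r_ind_def by (rule LeastI[of ?P N]) (use ex in blast)
  then have "\<not> r_ind V E r \<le> 2 ^ (k * d)" using not_ind_ramsey_small[OF d k1 k(1) _ K s] by blast
  then have "real (2 ^ (k * d)) \<le> real (r_ind V E r)" by (simp only: of_nat_le_iff)
  moreover have "real r \<le> 2 * 2 ^ k"
  proof -
    have "real r \<le> real (2 ^ (k + 1))" using k(2) by (simp only: of_nat_le_iff)
    then show ?thesis by simp
  qed
  then have "(real r / 2) ^ d \<le> (2 ^ k) ^ d" by (intro power_mono) auto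
  ultimately show ?thesis by (simp add: power_divide power_mult)
qed

text \<open>Host sides have size \<open>2 ^ l\<close>, so the desired size is rounded up; the bound
  on \<open>l\<close> later makes \<open>k\<close> logarithmic in \<open>r\<close>.\<close>

lemma exists_power_of_two_between:
  fixes t :: real
  assumes "t \<ge> 1"
  shows "\<exists>l. t \<le> 2 ^ l \<and> 2 ^ l \<le> 2 * t \<and> real l \<le> log 2 t + 1"
proof -
  define l where "l = nat \<lceil>log 2 t\<rceil>"
  have "log 2 t \<ge> 0" using assms by simp
  then have l: "log 2 t \<le> real l" "real l \<le> log 2 t + 1" by (auto simp: l_def)
  have p: "2 powr log 2 t = t" using assms by simp
  have "2 powr log 2 t \<le> 2 powr real l" using l by (intro powr_mono) auto
  moreover have "2 powr real l \<le> 2 powr (log 2 t + 1)" using l by (intro powr_mono) auto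
  ultimately show ?thesis using l p by (intro exI[of _ l]) (simp add: powr_realpow powr_add mult.commute)
qed

theorem theorem6p3:
  "\<forall>d::nat. d \<ge> 1 \<longrightarrow> (\<exists>s0::nat. \<forall>s\<ge>s0. \<forall>(V::nat set) E.
     d_bounded d V E \<and> contains_Kst d s V E \<longrightarrow>
     Theta_tilde_pow (\<lambda>r. real (r_ind V E r)) d)"
proof (intro allI impI)
  fix d :: nat assume d: "d \<ge> 1"
  show "\<exists>s0::nat. \<forall>s\<ge>s0. \<forall>(V::nat set) E. d_bounded d V E \<and> contains_Kst d s V E \<longrightarrow>
     Theta_tilde_pow (\<lambda>r. real (r_ind V E r)) d"
  \<comment> \<open>\<open>s\<close> has to exceed the solution count for the lower bound and to be
    at least \<open>d\<close> for \<open>d_bounded_parts\<close>; the sum secures both.\<close>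
  proof (intro exI[of _ "d + (d * (d + 3)) ^ d + 1"] allI impI, elim conjE)
    fix s :: nat and V :: "nat set" and E
    assume s: "d + (d * (d + 3)) ^ d + 1 \<le> s" and H: "d_bounded d V E" and K: "contains_Kst d s V E"
    define v where "v = card V"
    have v: "v \<ge> 1"
    proof -
      obtain Y where "Y \<subseteq> V" "card Y = d" using K by (auto simp: contains_Kst_def)
      moreover have "finite V" using H by (auto simp: d_bounded_def graph_def)
      ultimately have "d \<le> v" using card_mono[of V Y] by (simp add: v_def)
      then show ?thesis using d by simp
    qed
    \<comment> \<open>\<open>K0 * L\<close> will bound \<open>log 2 t\<close>, and
      \<open>K1 * L\<close> will bound \<open>k\<close>. \<open>K2\<close> gathers the size
      condition into a multiple of \<open>real k ^ v\<close>, and \<open>K3\<close> also takes in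
      \<open>K1 ^ v\<close> and the \<open>2 ^ d\<close> from density 1/(2r).\<close>
    define K0 :: real where "K0 = (d + v + 1) / ln 2"
    define K1 :: real where "K1 = 2 * K0 + 4"
    define K2 :: real where "K2 = 2 * v\<^sup>2 * 2 ^ v + 4 * v\<^sup>2 + 3"
    define K3 :: real where "K3 = d * K2 * 2 ^ d * K1 ^ v"
    have bounds: "(1 / 2) ^ d * real r ^ d \<le> real (r_ind V E r) \<and>
        real (r_ind V E r) \<le> 4 * real r ^ d * ln (real r) powr real (v + 1)"
      if r2: "r \<ge> 2" and lnr: "ln (real r) \<ge> 1" "ln (real r) \<ge> K3" for r
    proof -
      define L where "L = ln (real r)"
      \<comment> \<open>The size condition consumes \<open>L ^ v\<close>; the additional factor
        \<open>L\<close> absorbs the constant \<open>K3\<close>.\<close>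
      define t where "t = real r ^ d * L ^ (v + 1)"
      have L: "L \<ge> 1" "L \<ge> K3" using lnr by (simp_all add: L_def)
      have "real r ^ d \<ge> 1" "L ^ (v + 1) \<ge> 1" by (rule one_le_power, use r2 L in simp)+
      then have t1: "t \<ge> 1" unfolding t_def using mult_mono[of 1 "real r ^ d" 1 "L ^ (v + 1)"] by simp
      from exists_power_of_two_between[OF this] obtain l
        where l: "t \<le> 2 ^ l" "2 ^ l \<le> 2 * t" "real l \<le> log 2 t + 1" by blast
      define k where "k = 2 * l + 2"
      have "ln t = d * L + (v + 1) * ln L"
        unfolding t_def using r2 L by (simp add: ln_mult ln_realpow L_def distrib_right)
      also have "\<dots> \<le> d * L + (v + 1) * L"
        using L ln_le_minus_one[of L] by (intro add_left_mono mult_left_mono) auto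
      also have "\<dots> = (d + v + 1) * L" by (simp add: algebra_simps)
      finally have "log 2 t \<le> (d + v + 1) * L / ln 2"
        unfolding log_def by (intro divide_right_mono) auto
      also have "\<dots> = K0 * L" by (simp add: K0_def)
      finally have "real k \<le> 2 * (K0 * L) + 4" using l(3) by (simp add: k_def)
      also have "\<dots> \<le> K1 * L" using L by (simp add: K1_def algebra_simps)
      finally have kL: "real k \<le> K1 * L" .
      have k1: "real k \<ge> 1" by (simp add: k_def)
      have kv: "1 \<le> real k ^ v" "real k \<le> real k ^ v"
        using k1 v by (auto intro: one_le_power self_le_power)
      have "real (d * (2 * v * (v * (2 * k) ^ v) + (2 * v\<^sup>2 * (k + 1) + 1) + 2)) =
        d * (2 * v\<^sup>2 * 2 ^ v * real k ^ v + 2 * v\<^sup>2 * real k + 2 * v\<^sup>2 + 3)"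
        by (simp add: power_mult_distrib power2_eq_square algebra_simps)
      also have "\<dots> \<le> d * (2 * v\<^sup>2 * 2 ^ v * real k ^ v + 2 * v\<^sup>2 * real k ^ v + 2 * v\<^sup>2 * real k ^ v + 3 * real k ^ v)"
        using kv by (intro mult_left_mono add_mono) (auto simp: mult_le_cancel_left1)
      also have "\<dots> = d * K2 * real k ^ v" by (simp add: K2_def algebra_simps)
      also have "\<dots> \<le> d * K2 * (K1 * L) ^ v"
        using kL by (intro mult_left_mono power_mono) (auto simp: K2_def)
      also have "\<dots> = K3 * L ^ v / 2 ^ d" by (simp add: K3_def power_mult_distrib)
      also have "\<dots> \<le> L * L ^ v / 2 ^ d"
        using L by (intro divide_right_mono mult_right_mono) auto
      also have "\<dots> = t * (1 / (2 * real r)) ^ d"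
        using r2 by (simp add: t_def power_divide power_mult_distrib)
      also have "\<dots> \<le> 2 ^ l * (1 / (2 * real r)) ^ d" using l(1) by (intro mult_right_mono) auto
      finally have large: "real (d * (2 * v * (v * (2 * k) ^ v) + (2 * v\<^sup>2 * (k + 1) + 1) + 2))
          \<le> 2 ^ l * (1 / (2 * real r)) ^ d" .
      have "s \<ge> d" "r \<ge> 1" using s r2 by auto
      from exists_ind_ramsey_graph[OF H K d this v_def k_def large]
      obtain EG where EG: "graph {0..<2 * 2 ^ l} EG" "ind_ramsey_graph V E r {0..<2 * 2 ^ l :: nat} EG"
        by blast
      have "r_ind V E r \<le> 2 * 2 ^ l"
        unfolding r_ind_def by (rule Least_le) (use EG in blast)
      then have "real (r_ind V E r) \<le> real (2 * 2 ^ l)" by (simp only: of_nat_le_iff)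
      also have "\<dots> \<le> 4 * t" using l(2) by simp
      also have "\<dots> = 4 * real r ^ d * ln (real r) powr real (v + 1)"
        using L by (simp only: t_def powr_realpow L_def[symmetric] mult.assoc)
      finally show ?thesis using r_ind_lower[OF d r2 K _ EG] s by simp
    qed
    have ln_top: "filterlim (\<lambda>r. ln (real r)) at_top sequentially"
      by (rule filterlim_compose[OF ln_at_top filterlim_real_sequentially])
    have "\<forall>\<^sub>F r in sequentially. r \<ge> 2 \<and> ln (real r) \<ge> 1 \<and> ln (real r) \<ge> K3"
      using ln_top by (intro eventually_conj eventually_ge_at_top) (auto simp: filterlim_at_top)
    \<comment> \<open>The exponent 0 records that the lower bound loses no logarithm.\<close>
    then have "\<forall>\<^sub>F r in sequentially.
        (1 / 2) ^ d * real r ^ d / ln (real r) powr 0 \<le> real (r_ind V E r) \<and>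
        real (r_ind V E r) \<le> 4 * real r ^ d * ln (real r) powr real (v + 1)"
    proof (rule eventually_mono)
      fix r :: nat assume r: "r \<ge> 2 \<and> ln (real r) \<ge> 1 \<and> ln (real r) \<ge> K3"
      then have "ln (real r) powr 0 = 1" by simp
      then show "(1 / 2) ^ d * real r ^ d / ln (real r) powr 0 \<le> real (r_ind V E r) \<and>
        real (r_ind V E r) \<le> 4 * real r ^ d * ln (real r) powr real (v + 1)"
        using bounds[of r] r by simp
    qed
    then show "Theta_tilde_pow (\<lambda>r. real (r_ind V E r)) d"
      unfolding Theta_tilde_pow_def
      by (intro exI[of _ "(1 / 2) ^ d"] exI[of _ 4] exI[of _ 0] exI[of _ "real (v + 1)"]) simp
  qed
qed

end
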